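(* Let $\alpha\approx -3.09997$ be a root of the equation $2\cdot 5^{\alpha}-6^{\alpha+1}+4\cdot 7^{\alpha}=0$. Let $n\ge 3$ and let $B_n\in\Omega_n$ be a polyomino chain having $n$ squares. Then $$\chi_\alpha(B_n)\le 3\cdot 6^\alpha n+\left(2\cdot 4^\alpha+2\cdot 5^\alpha+6^\alpha-4\cdot 7^\alpha\right),$$ with equality if and only if $B_n$ does not contain any segment of length 2.
   Context: For a graph $G$ and a nonzero real number $\alpha$, the general sum-connectivity index is $\chi_\alpha(G)=\sum_{uv\in E(G)}(d_u+d_v)^\alpha$, where $d_u$ is the degree of the vertex $u$. A polyomino system is a connected geometric figure obtained by concatenating congruent squares side to side in the plane so that the figure divides the plane into one infinite (external) region and a number of finite (internal) regions, all internal regions being congruent squares. Two squares are adjacent if they share a side. A polyomino chain is a polyomino system in which every square is adjacent to at most two other squares; the squares are arranged in a linear order in which exactly the consecutive squares are adjacent (so for $n\ge 2$ there are two terminal squares; the cyclic $2\times 2$ block of four squares is not considered a chain). A polyomino chain is identified with its graph: vertices are the corners of the squares, edges are the sides of the squares. Degrees are taken in this graph. A square adjacent to exactly one (respectively two) other square(s) is called terminal (respectively non-terminal). A kink is a non-terminal square having a vertex of degree 2. A linear chain is a polyomino chain without kinks. A segment is a maximal linear chain in a polyomino chain, including the kinks and/or terminal squares at its ends; its length is its number of squares. A segment is external if it contains a terminal square, and internal otherwise. $\Omega_n$ is the collection of all polyomino chains with $n$ squares in which no internal segment of length 3 has an edge connecting two vertices of degree 3. *)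

theory Defs
  imports "HOL-Analysis.Analysis"
begin

section \<open>Degrees and the general sum-connectivity index\<close>

text \<open>A simple graph enters only through its edge set, a set of two-element vertex sets.\<close>

definition vdegree :: "'v set set \<Rightarrow> 'v \<Rightarrow> nat" where
  "vdegree E v = card {e \<in> E. v \<in> e}"

definition sum_connectivity :: "real \<Rightarrow> 'v set set \<Rightarrow> real" where
  "sum_connectivity \<alpha> E = (\<Sum>e\<in>E. real (\<Sum>v\<in>e. vdegree E v) powr \<alpha>)"

section \<open>Squares in the plane\<close>

text \<open>
  Congruent squares attached side to side lie, up to similarity, on the unit lattice. The square
  with lower left corner \<open>(x, y)\<close> is represented by that corner, an integer point.
\<close>

type_synonym square = "int \<times> int"
type_synonym corner = "int \<times> int"

fun sides :: "square \<Rightarrow> corner set set" where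
  "sides (x, y) =
    {{(x, y), (x + 1, y)}, {(x, y + 1), (x + 1, y + 1)},
     {(x, y), (x, y + 1)}, {(x + 1, y), (x + 1, y + 1)}}"

definition corners :: "square \<Rightarrow> corner set" where
  "corners s = \<Union> (sides s)"

definition adjacent :: "square \<Rightarrow> square \<Rightarrow> bool" where
  "adjacent s t \<longleftrightarrow> s \<noteq> t \<and> sides s \<inter> sides t \<noteq> {}"

definition neighbours :: "square set \<Rightarrow> square \<Rightarrow> square set" where
  "neighbours C s = {t \<in> C. adjacent s t}"

definition edges :: "square set \<Rightarrow> corner set set" where
  "edges C = (\<Union>s\<in>C. sides s)"

definition point :: "corner \<Rightarrow> real \<times> real" where
  "point v = (real_of_int (fst v), real_of_int (snd v))"

definition figure :: "square set \<Rightarrow> (real \<times> real) set" where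
  "figure C = (\<Union>e\<in>edges C. convex hull (point ` e))"

definition square_interior :: "square \<Rightarrow> (real \<times> real) set" where
  "square_interior s = box (point s) (point s + (1, 1))"

section \<open>Polyomino systems and chains\<close>

text \<open>
  The regions into which a figure divides the plane are the connected components of its
  complement. The internal ones are exactly the squares of the system: in particular a unit hole
  enclosed by squares is itself one of the squares.
\<close>

definition polyomino_system :: "square set \<Rightarrow> bool" where
  "polyomino_system C \<longleftrightarrow>
    finite C \<and> C \<noteq> {} \<and>
    (\<forall>s\<in>C. \<forall>t\<in>C. (s, t) \<in> {(p, q). p \<in> C \<and> q \<in> C \<and> adjacent p q}\<^sup>*) \<and>
    (\<exists>!R. R \<in> components (- figure C) \<and> \<not> bounded R) \<and>
    {R \<in> components (- figure C). bounded R} = square_interior ` C"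

definition polyomino_chain :: "square set \<Rightarrow> bool" where
  "polyomino_chain C \<longleftrightarrow>
    polyomino_system C \<and>
    (\<forall>s\<in>C. card (neighbours C s) \<le> 2) \<and>
    (\<exists>xs. distinct xs \<and> set xs = C \<and>
      (\<forall>i<length xs. \<forall>j<length xs.
        adjacent (xs ! i) (xs ! j) \<longleftrightarrow> j = i + 1 \<or> i = j + 1))"

definition terminal :: "square set \<Rightarrow> square \<Rightarrow> bool" where
  "terminal C s \<longleftrightarrow> s \<in> C \<and> card (neighbours C s) = 1"

definition non_terminal :: "square set \<Rightarrow> square \<Rightarrow> bool" where
  "non_terminal C s \<longleftrightarrow> s \<in> C \<and> card (neighbours C s) = 2"

definition kink :: "square set \<Rightarrow> square \<Rightarrow> bool" where
  "kink C s \<longleftrightarrow> non_terminal C s \<and> (\<exists>v\<in>corners s. vdegree (edges C) v = 2)"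

definition linear_chain :: "square set \<Rightarrow> bool" where
  "linear_chain C \<longleftrightarrow> polyomino_chain C \<and> (\<forall>s\<in>C. \<not> kink C s)"

text \<open>
  Whether \<open>S\<close> is linear is judged within \<open>S\<close> itself, so its end squares may be kinks of \<open>C\<close>.
  The length of a segment is its cardinality.
\<close>

definition segment :: "square set \<Rightarrow> square set \<Rightarrow> bool" where
  "segment C S \<longleftrightarrow>
    S \<subseteq> C \<and> linear_chain S \<and> (\<forall>T. S \<subseteq> T \<and> T \<subseteq> C \<and> linear_chain T \<longrightarrow> T = S)"

definition external_segment :: "square set \<Rightarrow> square set \<Rightarrow> bool" where
  "external_segment C S \<longleftrightarrow> segment C S \<and> (\<exists>s\<in>S. terminal C s)"

definition internal_segment :: "square set \<Rightarrow> square set \<Rightarrow> bool" where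
  "internal_segment C S \<longleftrightarrow> segment C S \<and> \<not> external_segment C S"

text \<open>The degrees below are taken in the graph of the whole chain, not in that of the segment.\<close>

definition Omega :: "nat \<Rightarrow> square set set" where
  "Omega n =
    {C. polyomino_chain C \<and> card C = n \<and>
      (\<forall>S. internal_segment C S \<and> card S = 3 \<longrightarrow>
        \<not> (\<exists>e\<in>edges S. \<forall>v\<in>e. vdegree (edges C) v = 3))}"

end

theory Submission
  imports Defs
begin

text \<open>
  List the squares of the chain as \<open>x 0, \<dots>, x (n - 1)\<close>. Two squares of the chain that share only a
  corner have a third square of the chain at that corner: otherwise Janiszewski's theorem, applied
  to the two parts of the chain obtained by cutting it between them, would show that the chain
  encloses a region that is not one of its squares. Hence the degree of a vertex is one more than
  the number of squares at it, and the degree sum of a side of \<open>x i\<close> is determined by the squares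
  \<open>x (i - 2), \<dots>, x (i + 2)\<close>. Summing the weights of the sides square by square and subtracting
  the sides shared by consecutive squares writes the index as a sum over consecutive pairs, in
  which, for chains in \<open>\<Omega>\<^sub>n\<close>, only the positions of the kinks matter. The equation for \<open>\<alpha>\<close> makes
  an isolated kink weightless, whereas two consecutive kinks cost \<open>6\<^sup>\<alpha> - 8\<^sup>\<alpha>\<close> and a kink next to a
  terminal square costs \<open>6\<^sup>\<alpha> - 7\<^sup>\<alpha>\<close>; these pairs are exactly the segments of length 2.
\<close>

section \<open>The region covered by a polyomino system\<close>

definition cell :: "square \<Rightarrow> (real \<times> real) set" where
  "cell s = cbox (point s) (point s + (1, 1))"

definition shift_dirs :: "square set" where
  "shift_dirs = {(1, 0), (- 1, 0), (0, 1), (0, - 1)}"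

lemma cell_Pair: "cell (a, b) = {real_of_int a..real_of_int a + 1} \<times> {real_of_int b..real_of_int b + 1}"
  by (simp add: cell_def point_def cbox_Pair_eq)

lemma square_interior_Pair:
  "square_interior (a, b) =
    {real_of_int a<..<real_of_int a + 1} \<times> {real_of_int b<..<real_of_int b + 1}"
  by (simp add: square_interior_def point_def box_prod box_real)

lemma corners_Pair: "corners (a, b) = {a, a + 1} \<times> {b, b + 1}"
  by (auto simp: corners_def)

text \<open>The drawn sides of a square make up its boundary, so \<open>figure C\<close> is the
  union of the boundaries of the squares.\<close>

lemma hull_sides:
  "(\<Union>e\<in>sides s. convex hull (point ` e)) = cell s - square_interior s"
proof (cases s)
  case (Pair a b)
  have h: "convex hull {(c, e), (d, e)} = {c..d} \<times> {e}"
    and v: "convex hull {(e, c), (e, d)} = {e} \<times> {c..d}" if "c \<le> d" for c d e :: real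
    using that convex_hull_Times[of "{c, d}" "{e}"] convex_hull_Times[of "{e}" "{c, d}"]
    by (simp_all add: segment_convex_hull[symmetric] closed_segment_eq_real_ivl)
  show ?thesis
    unfolding Pair by (auto simp: point_def h v cell_Pair square_interior_Pair)
qed

lemma figure_eq: "figure C = (\<Union>s\<in>C. cell s - square_interior s)"
  by (simp add: figure_def edges_def flip: hull_sides)

lemma square_interior_subset_cell: "square_interior s \<subseteq> cell s"
  by (cases s) (auto simp: cell_Pair square_interior_Pair)

lemma Un_cells: "(\<Union>s\<in>C. cell s) = figure C \<union> \<Union> (square_interior ` C)"
proof -
  have "cell s = (cell s - square_interior s) \<union> square_interior s" for s
    using square_interior_subset_cell[of s] by auto
  then have "(\<Union>s\<in>C. cell s) = (\<Union>s\<in>C. (cell s - square_interior s) \<union> square_interior s)"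
    by simp
  then show ?thesis by (simp only: figure_eq UN_Un_distrib)
qed

text \<open>The regions of the figure are one unbounded component and the open squares of the
  system. Filling in the squares therefore leaves exactly the unbounded component.\<close>

lemma connected_outside_cells:
  assumes "polyomino_system C"
  shows "connected (- (\<Union>s\<in>C. cell s))"
proof -
  have ex1: "\<exists>!R. R \<in> components (- figure C) \<and> \<not> bounded R"
    using assms unfolding polyomino_system_def by (elim conjE)
  have bd: "{R \<in> components (- figure C). bounded R} = square_interior ` C"
    using assms unfolding polyomino_system_def by (elim conjE)
  obtain R where R: "R \<in> components (- figure C)" "\<not> bounded R"
    using ex1 by (elim ex1E conjE)
  have uniq: "R' = R" if "R' \<in> components (- figure C)" "\<not> bounded R'" for R'
    using ex1 R that by (elim ex1E) metis
  have comps: "components (- figure C) = insert R (square_interior ` C)"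
  proof -
    have "components (- figure C) = insert R {R \<in> components (- figure C). bounded R}"
      using R(1) uniq by auto
    then show ?thesis unfolding bd .
  qed
  have disj: "R \<inter> \<Union> (square_interior ` C) = {}"
  proof -
    have "R \<inter> X = {}" if "X \<in> square_interior ` C" for X
    proof -
      have "X \<in> {R \<in> components (- figure C). bounded R}" using that unfolding bd .
      then have "X \<in> components (- figure C)" "X \<noteq> R" using R(2) by auto
      then show ?thesis using components_nonoverlap[OF R(1)] by metis
    qed
    then show ?thesis by (simp only: Int_Union) auto
  qed
  have "- figure C = R \<union> \<Union> (square_interior ` C)"
    using Union_components[of "- figure C"] comps by auto
  then have "- (\<Union>s\<in>C. cell s) = R"
    using disj unfolding Un_cells by (simp add: Compl_Un) blast
  then show ?thesis
    using R in_components_connected by blast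
qed

text \<open>Janiszewski's theorem for the complex plane, carried over along the homeomorphism
  \<open>h\<close> with inverse \<open>g\<close>.\<close>

lemma Janiszewski_dual_prod:
  fixes S T :: "(real \<times> real) set"
  assumes "compact S" "compact T" "connected S" "connected T" "connected (- (S \<union> T))"
  shows "connected (S \<inter> T)"
proof -
  define h :: "real \<times> real \<Rightarrow> complex" where "h = (\<lambda>z. Complex (fst z) (snd z))"
  define g :: "complex \<Rightarrow> real \<times> real" where "g = (\<lambda>z. (Re z, Im z))"
  have gh: "g (h z) = z" and hg: "h (g w) = w" for z w by (auto simp: g_def h_def)
  have "h = (\<lambda>z. of_real (fst z) + \<i> * of_real (snd z))"
    by (auto simp: h_def complex_eq_iff fun_eq_iff)
  then have ch: "continuous_on X h" for X by (auto intro!: continuous_intros)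
  have cg: "continuous_on X g" for X unfolding g_def by (intro continuous_intros)
  have inj: "inj h" using gh by (metis injI)
  have surj: "surj h" using hg by (metis surjI)
  have "connected (h ` S \<inter> h ` T)"
  proof (rule Janiszewski_dual)
    have "- (h ` S \<union> h ` T) = h ` (- (S \<union> T))"
      using bij_image_Compl_eq[of h "S \<union> T"] inj surj by (simp add: bij_def image_Un)
    then show "connected (- (h ` S \<union> h ` T))"
      using assms ch by (metis connected_continuous_image)
  qed (use assms ch compact_continuous_image connected_continuous_image in blast)+
  then have "connected (g ` (h ` (S \<inter> T)))"
    using connected_continuous_image[OF cg] by (simp add: image_Int[OF inj])
  then show ?thesis by (simp add: image_image gh)
qed

lemma adjacent_iff: "adjacent s t \<longleftrightarrow> t - s \<in> shift_dirs"
  by (cases s; cases t) (auto simp: adjacent_def shift_dirs_def doubleton_eq_iff)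

text \<open>If both coordinates of \<open>s\<close> and \<open>t\<close> differ, the squares lie
  diagonally across \<open>v\<close>, and the intervals spanned by them meet in a single point in
  either coordinate.\<close>

lemma shared_corners:
  assumes "v \<in> corners s" "v \<in> corners t"
  shows "s = t \<or> adjacent s t \<or> cell s \<inter> cell t = {point v}"
proof -
  obtain a b c d p q where st: "s = (a, b)" "t = (c, d)" "v = (p, q)" by (metis surj_pair)
  have ab: "a = p \<or> a = p - 1" "b = q \<or> b = q - 1" "c = p \<or> c = p - 1" "d = q \<or> d = q - 1"
    using assms by (auto simp: st corners_Pair)
  have one: "{real_of_int e..real_of_int e + 1} \<inter> {real_of_int f..real_of_int f + 1} = {real_of_int g}"
    if "e \<noteq> f" "e = g \<or> e = g - 1" "f = g \<or> f = g - 1" for e f g :: int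
    using that by auto
  show ?thesis
  proof (cases "a = c \<or> b = d")
    case True
    then show ?thesis using ab by (auto simp: st adjacent_iff shift_dirs_def)
  next
    case False
    then show ?thesis
      using one[of a c p] one[of b d q] ab by (simp add: st cell_Pair Times_Int_Times point_def)
  qed
qed

lemma adjacent_obtains_corner:
  assumes "adjacent s t"
  obtains v where "v \<in> corners s" "v \<in> corners t"
proof -
  obtain e where e: "e \<in> sides s" "e \<in> sides t" using assms by (auto simp: adjacent_def)
  moreover have "e \<noteq> {}" using e(1) by (cases s) auto
  ultimately show ?thesis using that by (auto simp: corners_def)
qed

lemma point_in_cell: "v \<in> corners s \<Longrightarrow> point v \<in> cell s"
  by (cases s; cases v) (auto simp: corners_Pair cell_Pair point_def)

text \<open>The open box reaches to distance 1 from a lattice point and hence meets only the four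
  closed squares around it. This is what isolates a pinch point.\<close>

lemma cell_near_point:
  assumes "z \<in> cell s" "z \<in> box (point v - (1, 1)) (point v + (1, 1))"
  shows "v \<in> corners s"
proof -
  obtain a b where s: "s = (a, b)" by (cases s)
  obtain c d where v: "v = (c, d)" by (cases v)
  obtain p q where z: "z = (p, q)" by (cases z)
  have "a \<le> p" "p \<le> a + 1" "b \<le> q" "q \<le> b + 1" "c - 1 < p" "p < c + 1" "d - 1 < q" "q < d + 1"
    using assms by (auto simp: s v z cell_Pair point_def box_prod box_real)
  then have "a < c + 1" "c - 1 < a + 1" "b < d + 1" "d - 1 < b + 1" by linarith+
  then show ?thesis by (auto simp: s v corners_Pair)
qed

lemma connected_cells_interval:
  fixes x :: "nat \<Rightarrow> square"
  assumes "a \<le> b" "\<And>i. a \<le> i \<Longrightarrow> i < b \<Longrightarrow> adjacent (x i) (x (Suc i))"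
  shows "connected (\<Union>i\<in>{a..b}. cell (x i))"
  using assms
proof (induction b rule: dec_induct)
  case base
  then show ?case by (simp add: cell_def convex_connected)
next
  case (step b)
  obtain v where "v \<in> corners (x b)" "v \<in> corners (x (Suc b))"
    using step by (meson adjacent_obtains_corner lessI)
  then have "(\<Union>i\<in>{a..b}. cell (x i)) \<inter> cell (x (Suc b)) \<noteq> {}"
    using step(1) point_in_cell[of v "x b"] point_in_cell[of v "x (Suc b)"]
    by (metis IntI UN_I atLeastAtMost_iff emptyE order_refl)
  moreover have "connected (cell (x (Suc b)))" by (simp add: cell_def convex_connected)
  moreover have "connected (\<Union>i\<in>{a..b}. cell (x i))" using step by auto
  ultimately have "connected ((\<Union>i\<in>{a..b}. cell (x i)) \<union> cell (x (Suc b)))"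
    by (intro connected_Un)
  moreover have "{a..Suc b} = insert (Suc b) {a..b}" using step by auto
  ultimately show ?case by (simp add: Un_commute)
qed

text \<open>
  Cut the chain behind one of two squares touching only in \<open>v\<close>. Both parts are continua whose union
  does not separate the plane, so they meet in a connected set; but \<open>v\<close> would be an isolated point
  of the intersection, which also contains the side along which the chain was cut.
\<close>

lemma no_pinch:
  fixes x :: "nat \<Rightarrow> square"
  assumes sys: "polyomino_system (x ` {..<n})"
    and adj: "\<And>i j. i < n \<Longrightarrow> j < n \<Longrightarrow> adjacent (x i) (x j) \<longleftrightarrow> j = i + 1 \<or> i = j + 1"
    and ij: "i < j" "j < n" "x i \<noteq> x j" "\<not> adjacent (x i) (x j)"
    and v: "v \<in> corners (x i)" "v \<in> corners (x j)"
  shows "\<exists>m<n. m \<noteq> i \<and> m \<noteq> j \<and> v \<in> corners (x m)"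
proof (rule ccontr)
  assume "\<not> ?thesis"
  then have only: "m = i \<or> m = j" if "m < n" "v \<in> corners (x m)" for m
    using that by blast
  define S where "S = (\<Union>m\<in>{0..i}. cell (x m))"
  define T where "T = (\<Union>m\<in>{i+1..n-1}. cell (x m))"
  have "{0..i} \<union> {i+1..n-1} = {..<n}" using ij by auto
  then have ST: "S \<union> T = (\<Union>s\<in>x ` {..<n}. cell s)"
    unfolding S_def T_def by blast
  have "connected S" unfolding S_def
    using ij adj by (intro connected_cells_interval) auto
  moreover have "connected T" unfolding T_def
    using ij adj by (intro connected_cells_interval) auto
  moreover have "compact S" "compact T"
    unfolding S_def T_def cell_def by (auto intro!: compact_UN)
  moreover have "connected (- (S \<union> T))"
    unfolding ST by (rule connected_outside_cells[OF sys])
  ultimately have conn: "connected (S \<inter> T)" by (intro Janiszewski_dual_prod)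
  let ?U = "box (point v - (1, 1)) (point v + (1, 1))"
  have iso: "z = point v" if z: "z \<in> ?U" "z \<in> S" "z \<in> T" for z
  proof -
    obtain a b where ab: "a \<le> i" "z \<in> cell (x a)" "i < b" "b < n" "z \<in> cell (x b)"
    proof -
      obtain a b where "a \<in> {0..i}" "z \<in> cell (x a)" "b \<in> {i+1..n-1}" "z \<in> cell (x b)"
        using z unfolding S_def T_def by blast
      then show ?thesis using that[of a b] ij by auto
    qed
    then have "v \<in> corners (x a)" "v \<in> corners (x b)" using z cell_near_point by blast+
    then have "a = i" "b = j" using only[of a] only[of b] ab ij by auto
    then show ?thesis using shared_corners[OF v] ij ab by blast
  qed
  have vU: "point v \<in> ?U" by (auto simp: box_prod box_real point_def)
  have vST: "point v \<in> S \<inter> T"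
    using ij v point_in_cell[of v "x i"] point_in_cell[of v "x j"]
    by (auto simp: S_def T_def intro: bexI[of _ i] bexI[of _ j])
  have "adjacent (x i) (x (i + 1))" using ij adj by auto
  then obtain w where w: "w \<in> corners (x i)" "w \<in> corners (x (i + 1))"
    by (meson adjacent_obtains_corner)
  \<comment> \<open>By \<open>only\<close>, the square \<open>x (i + 1)\<close> does not contain
    \<open>v\<close>. Hence any corner \<open>w\<close> of the side along which the chain is cut is
    a second point of the intersection.\<close>
  have "j \<noteq> i + 1" using ij adj by auto
  then have "w \<noteq> v" using only[of "i + 1"] w ij by auto
  then have "point w \<noteq> point v" by (auto simp: point_def prod_eq_iff)
  moreover have "point w \<in> S \<inter> T"
    using w ij point_in_cell[of w "x i"] point_in_cell[of w "x (i + 1)"]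
    by (auto simp: S_def T_def intro: bexI[of _ i] bexI[of _ "i + 1"])
  moreover have "?U \<inter> S \<inter> T = {} \<or> - {point v} \<inter> (S \<inter> T) = {}"
    using connectedD[OF conn open_box, of "- {point v}" "point v - (1, 1)" "point v + (1, 1)"] iso vU
    by blast
  ultimately show False using vU vST by blast
qed

section \<open>Convex unions of squares are polyomino systems\<close>

lemma frontier_interior_disjoint: "(cell s - square_interior s) \<inter> square_interior t = {}"
proof -
  obtain a b where s: "s = (a, b)" by (cases s)
  obtain c d where t: "t = (c, d)" by (cases t)
  have False if "(p, q) \<in> cell s - square_interior s" "(p, q) \<in> square_interior t" for p q
  proof -
    have h: "a \<le> p" "p \<le> a + 1" "b \<le> q" "q \<le> b + 1" "c < p" "p < c + 1" "d < q" "q < d + 1"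
      using that by (auto simp: s t cell_Pair square_interior_Pair)
    \<comment> \<open>Integers at distance less than 1 coincide, so the two squares are
      equal.\<close>
    then have "a < c + 1" "c < a + 1" "b < d + 1" "d < b + 1" by linarith+
    then have "s = t" using s t by auto
    then show False using that by auto
  qed
  then show ?thesis by auto
qed

lemma square_interior_disjoint:
  assumes "s \<noteq> t"
  shows "square_interior s \<inter> square_interior t = {}"
proof -
  obtain a b where s: "s = (a, b)" by (cases s)
  obtain c d where t: "t = (c, d)" by (cases t)
  have False if "(p, q) \<in> square_interior s" "(p, q) \<in> square_interior t" for p q
  proof -
    have h: "a < p" "p < a + 1" "b < q" "q < b + 1" "c < p" "p < c + 1" "d < q" "q < d + 1"
      using that by (auto simp: s t square_interior_Pair)
    then have "a < c + 1" "c < a + 1" "b < d + 1" "d < b + 1" by linarith+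
    then show False using assms s t by auto
  qed
  then show ?thesis by auto
qed

text \<open>A bounded convex set in the plane has a connected complement. That complement and the
  open squares are disjoint, open and connected and exhaust the complement of the figure, so they
  are its components. This suffices for the short straight chains needed to test the maximality of
  segments.\<close>

lemma polyomino_system_convex:
  assumes "finite C" "C \<noteq> {}"
    and conn: "\<And>s t. s \<in> C \<Longrightarrow> t \<in> C \<Longrightarrow> (s, t) \<in> {(p, q). p \<in> C \<and> q \<in> C \<and> adjacent p q}\<^sup>*"
    and conv: "convex (\<Union>s\<in>C. cell s)"
  shows "polyomino_system C"
proof -
  let ?K = "\<Union>s\<in>C. cell s"
  have cpt: "compact ?K" unfolding cell_def using assms by (auto intro!: compact_UN)
  have unb: "\<not> bounded (- ?K)"
    using cobounded_imp_unbounded[of "- ?K"] cpt by (auto simp: compact_imp_bounded)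
  have bd: "bounded (square_interior s)" for s
    by (auto simp: square_interior_def bounded_box)
  have ne: "square_interior s \<noteq> {}" for s
    by (cases s) (auto simp: square_interior_Pair)
  have comps: "components (- figure C) = insert (- ?K) (square_interior ` C)"
  proof (rule components_open_unique)
    show "pairwise disjnt (insert (- ?K) (square_interior ` C))"
    proof -
      have "pairwise disjnt (square_interior ` C)"
        by (intro pairwise_imageI) (auto simp: disjnt_def square_interior_disjoint)
      moreover have "disjnt (- ?K) X \<and> disjnt X (- ?K)" if "X \<in> square_interior ` C" for X
      proof -
        obtain s where "s \<in> C" "X = square_interior s" using \<open>X \<in> square_interior ` C\<close> by (elim imageE)
        then have "X \<subseteq> ?K" using square_interior_subset_cell[of s] by auto
        then show ?thesis unfolding disjnt_def by auto
      qed
      ultimately show ?thesis by (simp add: pairwise_insert)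
    qed
    show "\<Union> (insert (- ?K) (square_interior ` C)) = - figure C"
    proof -
      have "figure C \<inter> \<Union> (square_interior ` C) = {}"
        using frontier_interior_disjoint unfolding figure_eq by blast
      moreover have "?K = figure C \<union> \<Union> (square_interior ` C)" by (rule Un_cells)
      ultimately show ?thesis by auto
    qed
    fix X assume X: "X \<in> insert (- ?K) (square_interior ` C)"
    consider "X = - ?K" | s where "s \<in> C" "X = square_interior s" using X by (elim insertE imageE)
    then show "open X \<and> connected X \<and> X \<noteq> {}"
    proof cases
      case 1
      have "connected (- ?K)"
        using cpt conv by (intro connected_complement_bounded_convex) (auto simp: compact_imp_bounded)
      moreover have "open (- ?K)" using compact_imp_closed[OF cpt] by (rule open_Compl)
      moreover have "- ?K \<noteq> {}" using unb by (metis bounded_empty)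
      ultimately show ?thesis using 1 by simp
    next
      case 2
      then show ?thesis using ne by (auto simp: square_interior_def open_box convex_connected)
    qed
  qed
  show ?thesis
    unfolding polyomino_system_def comps using assms unb bd by auto
qed

section \<open>Squares and vertex degrees on the lattice\<close>

text \<open>Counts along one coordinate axis. The product \<open>side_overlap u w\<close> is the
  number of corners that the square at offset \<open>w\<close> has on the side in direction
  \<open>u\<close> of the square at the origin.\<close>

definition overlap :: "int \<Rightarrow> int \<Rightarrow> nat" where
  "overlap u w = card ({0, 1} \<inter> {u, u + 1} \<inter> {w, w + 1})"

definition side_overlap :: "square \<Rightarrow> square \<Rightarrow> nat" where
  "side_overlap u w = overlap (fst u) (fst w) * overlap (snd u) (snd w)"

text \<open>
  What the squares beyond one side of a square contribute to the degree sum of its side in direction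
  \<open>u\<close>: those reached by the step \<open>q\<close> and, if \<open>k = 1\<close>, by \<open>q\<close> and then a turn \<open>t\<close>. No square further
  along the chain touches it.
\<close>

definition arm :: "nat \<Rightarrow> square \<Rightarrow> square \<Rightarrow> square \<Rightarrow> nat" where
  "arm k q t u = side_overlap u q + k * side_overlap u (q + t)"

text \<open>A side is named by the square and a direction, whether or not the square beyond it
  belongs to the chain.\<close>

definition shared_side :: "square \<Rightarrow> square \<Rightarrow> corner set" where
  "shared_side s u = corners s \<inter> corners (s + u)"

lemma card_shared_side_corners:
  "card (shared_side s u \<inter> corners (s + w)) = side_overlap u w"
proof -
  obtain a b where s: "s = (a, b)" by (cases s)
  have *: "card ({a, a + 1} \<inter> {a + u, a + u + 1} \<inter> {a + w, a + w + 1}) = overlap u w" for a u w :: int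
  proof -
    have "{a, a + 1} \<inter> {a + u, a + u + 1} \<inter> {a + w, a + w + 1}
        = (+) a ` ({0, 1} \<inter> {u, u + 1} \<inter> {w, w + 1})"
      by auto
    then show ?thesis by (simp add: overlap_def card_image)
  qed
  show ?thesis
    by (cases u; cases w)
      (simp add: s shared_side_def side_overlap_def corners_Pair Times_Int_Times
        card_cartesian_product * del: insert_Times_insert)
qed

lemma overlap_simps [simp]:
  "overlap 0 0 = 2" "overlap 0 1 = 1" "overlap 0 (- 1) = 1" "overlap 0 2 = 0" "overlap 0 (- 2) = 0"
  "overlap 1 0 = 1" "overlap 1 1 = 1" "overlap 1 (- 1) = 0" "overlap 1 2 = 0" "overlap 1 (- 2) = 0"
  "overlap (- 1) 0 = 1" "overlap (- 1) 1 = 0" "overlap (- 1) (- 1) = 1" "overlap (- 1) 2 = 0"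
  "overlap (- 1) (- 2) = 0"
  by (simp_all add: overlap_def Int_insert_right)

lemma sides_eq_shared_side: "sides s = shared_side s ` shift_dirs"
  by (cases s) (auto simp: shared_side_def corners_Pair shift_dirs_def Times_Int_Times)

lemma inj_on_shared_side: "inj_on (shared_side s) shift_dirs"
proof (cases s)
  case (Pair a b)
  have "shared_side s (1, 0) = {a + 1} \<times> {b, b + 1}" "shared_side s (- 1, 0) = {a} \<times> {b, b + 1}"
    "shared_side s (0, 1) = {a, a + 1} \<times> {b + 1}" "shared_side s (0, - 1) = {a, a + 1} \<times> {b}"
    by (auto simp: Pair shared_side_def corners_Pair)
  then show ?thesis
    by (auto simp: inj_on_def shift_dirs_def times_eq_iff doubleton_eq_iff)
qed

lemma sum_sides: "(\<Sum>e\<in>sides s. f e) = (\<Sum>u\<in>shift_dirs. f (shared_side s u))"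
  by (simp add: sides_eq_shared_side sum.reindex[OF inj_on_shared_side])

lemma uminus_shift_dirs: "u \<in> shift_dirs \<Longrightarrow> - u \<in> shift_dirs"
  by (auto simp: shift_dirs_def)

lemma card_shared_side:
  assumes "u \<in> shift_dirs"
  shows "card (shared_side s u) = 2"
proof -
  have "shared_side s u \<inter> corners (s + (0, 0)) = shared_side s u"
    by (cases s) (simp add: shared_side_def Int_commute)
  then have "card (shared_side s u) = side_overlap u (0, 0)"
    by (metis card_shared_side_corners)
  then show ?thesis using assms by (auto simp: shift_dirs_def side_overlap_def)
qed

text \<open>A common side lies in the set of common corners; both have two elements, so they
  agree.\<close>

lemma sides_Int_sides:
  assumes "u \<in> shift_dirs"
  shows "sides s \<inter> sides (s + u) = {shared_side s u}"
proof -
  have "shared_side s u = shared_side (s + u) (- u)" by (simp add: shared_side_def Int_commute)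
  moreover have "shared_side s u \<in> sides s" "shared_side (s + u) (- u) \<in> sides (s + u)"
    unfolding sides_eq_shared_side by (intro imageI assms uminus_shift_dirs)+
  ultimately have "shared_side s u \<in> sides s \<inter> sides (s + u)" by simp
  moreover have "e = shared_side s u" if e: "e \<in> sides s" "e \<in> sides (s + u)" for e
  proof (rule card_subset_eq)
    show "finite (shared_side s u)" using card_shared_side[OF assms, of s] card.infinite by fastforce
    show "e \<subseteq> shared_side s u" using that by (auto simp: shared_side_def corners_def)
    show "card e = card (shared_side s u)"
    proof -
      obtain u' where "e = shared_side s u'" "u' \<in> shift_dirs"
        using e(1) unfolding sides_eq_shared_side by (elim imageE)
      then show ?thesis by (simp only: card_shared_side assms)
    qed
  qed
  ultimately show ?thesis by blast
qed

text \<open>The square two steps straight ahead no longer touches the starting square.\<close>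

lemma straight_overlap:
  assumes "u \<in> shift_dirs" "q \<in> shift_dirs"
  shows "side_overlap u (q + q) = 0"
  using assms by (auto simp: shift_dirs_def side_overlap_def)

section \<open>Weights of the sides around a single square\<close>

definition perp :: "square \<Rightarrow> square \<Rightarrow> bool" where
  "perp t q \<longleftrightarrow> t \<in> shift_dirs \<and> t \<noteq> q \<and> t \<noteq> - q"

text \<open>
  The weights of the four sides of a non-terminal square split into two shares, each depending only
  on whether this square (\<open>k\<close>) and one of its neighbours (\<open>b\<close>) are kinks.
\<close>

definition cell_share :: "(nat \<Rightarrow> real) \<Rightarrow> nat \<Rightarrow> nat \<Rightarrow> real" where
  "cell_share f k b = (if k = 0 then 2 * f (6 + b) else f (5 + b) + f (7 + b))"

lemma shift_dirs_perp:
  assumes "q \<in> shift_dirs" "perp t q"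
  shows "shift_dirs = {q, - q, t, - t}" "q \<noteq> - q" "q \<noteq> t" "- q \<noteq> t" "q \<noteq> - t" "t \<noteq> - t"
proof -
  have "q = (1, 0) \<or> q = (- 1, 0) \<or> q = (0, 1) \<or> q = (0, - 1)"
    using assms(1) by (simp add: shift_dirs_def)
  moreover have "t = (1, 0) \<or> t = (- 1, 0) \<or> t = (0, 1) \<or> t = (0, - 1)"
    using assms(2) by (simp add: shift_dirs_def perp_def)
  ultimately show "shift_dirs = {q, - q, t, - t}" "q \<noteq> - q" "q \<noteq> t" "- q \<noteq> t" "q \<noteq> - t" "t \<noteq> - t"
    using assms(2) by (elim disjE; simp add: perp_def shift_dirs_def insert_commute)+
qed

lemma sum_shift_dirs:
  fixes g :: "square \<Rightarrow> real"
  assumes "q \<in> shift_dirs" "perp t q"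
  shows "(\<Sum>u\<in>shift_dirs. g u) = g q + (g (- q) + (g t + g (- t)))"
proof -
  note d = shift_dirs_perp[OF assms]
  have "q \<notin> {- q, t, - t}" "- q \<notin> {t, - t}" "t \<notin> {- t}" using d(2-6) by auto
  then show ?thesis
    unfolding d(1)
    by (simp only: sum.insert finite.intros empty_iff not_False_eq_True sum.empty add_0_right)
qed

lemma perp_eq:
  assumes "q \<in> shift_dirs" "perp t q" "perp t' q"
  shows "t' = t \<or> t' = - t"
  using shift_dirs_perp[OF assms(1,2)] assms(3) by (auto simp: perp_def)

lemma perp_sym: "q \<in> shift_dirs \<Longrightarrow> perp t q \<Longrightarrow> perp q t"
  using shift_dirs_perp[of q t] by (auto simp: perp_def)

text \<open>The square at \<open>q\<close> has two corners on the side facing it and one on each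
  lateral side. A turned square adds one corner to the facing side and one to the lateral side
  towards which it turns.\<close>

lemma arm_eq:
  assumes "q \<in> shift_dirs" "perp t q"
  shows "arm k q t q = 2 + k" "arm k q t (- q) = 0" "arm k q t t = 1 + k" "arm k q t (- t) = 1"
proof -
  have "q = (1, 0) \<or> q = (- 1, 0) \<or> q = (0, 1) \<or> q = (0, - 1)"
    using assms(1) by (simp add: shift_dirs_def)
  moreover have "t = (1, 0) \<or> t = (- 1, 0) \<or> t = (0, 1) \<or> t = (0, - 1)"
    using assms(2) by (simp add: shift_dirs_def perp_def)
  ultimately show "arm k q t q = 2 + k" "arm k q t (- q) = 0" "arm k q t t = 1 + k"
      "arm k q t (- t) = 1"
    using assms(2) by (elim disjE; simp add: perp_def arm_def side_overlap_def)+
qed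

text \<open>The assumptions \<open>t \<noteq> q\<close> and \<open>t' \<noteq> p\<close> keep an arm
  from turning back against the other arm. The last assumption excludes a U: if both arms of a
  straight square turn to the same side, its lateral sides have degree sums 8 and 6 instead of 7 and
  7.\<close>

lemma sum_inner_cell:
  assumes "p \<in> shift_dirs" "q \<in> shift_dirs" "p \<noteq> q" "perp t p" "perp t' q"
    and "k = 0 \<or> k = 1" "k' = 0 \<or> k' = 1"
    and "k = 1 \<Longrightarrow> t \<noteq> q" "k' = 1 \<Longrightarrow> t' \<noteq> p"
    and "p = - q \<Longrightarrow> k = 1 \<Longrightarrow> k' = 1 \<Longrightarrow> t \<noteq> t'"
  shows "(\<Sum>u\<in>shift_dirs. f (4 + arm k p t u + arm k' q t' u))
    = cell_share f (of_bool (p \<noteq> - q)) k + cell_share f (of_bool (p \<noteq> - q)) k'"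
proof (cases "p = - q")
  case True
  have "perp t q" using assms(4) unfolding perp_def True by auto
  then have t: "t = t' \<or> t = - t'" using perp_eq assms by blast
  have "arm k p t (- q) = 2 + k" "arm k p t q = 0" "arm k p t t = 1 + k" "arm k p t (- t) = 1"
    using arm_eq[OF assms(1,4), of k] by (simp_all add: True)
  then show ?thesis
    unfolding sum_shift_dirs[OF assms(2,5)]
    using arm_eq[OF assms(2,5), of k'] t assms(6,7,10)
    by (elim disjE) (simp_all add: True cell_share_def add_ac)
next
  case False
  then have "perp p q" using assms by (simp add: perp_def)
  note d = shift_dirs_perp[OF assms(2) \<open>perp p q\<close>]
  have t': "t' = p \<or> t' = - p" using perp_eq assms(2,5) \<open>perp p q\<close> by blast
  have t: "t = q \<or> t = - q"
    using perp_eq[OF assms(1) perp_sym[OF assms(2) \<open>perp p q\<close>] assms(4)] .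
  show ?thesis
    unfolding sum_shift_dirs[OF assms(2) \<open>perp p q\<close>]
    using arm_eq[OF assms(2,5), of k'] arm_eq[OF assms(1,4), of k] t t' d(2-6) assms(6-9)
    by (elim disjE) (simp_all add: False cell_share_def add_ac)
qed

lemma sum_end_cell:
  fixes f :: "nat \<Rightarrow> real"
  assumes "q \<in> shift_dirs" "perp t q"
  shows "(\<Sum>u\<in>shift_dirs. f (4 + arm k q t u)) = f 4 + f 5 + (f (5 + k) + f (6 + k))"
  using arm_eq[OF assms, of k] by (simp add: sum_shift_dirs[OF assms] add_ac)

text \<open>If the square is straight, the arm lies behind it and misses the side \<open>q\<close>.
  At a kink the first square of the arm contributes one corner, and its turn, leading away from
  \<open>q\<close>, contributes none.\<close>

lemma arm_across:
  assumes "p \<in> shift_dirs" "q \<in> shift_dirs" "p \<noteq> q" "perp t p"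
    and "k = 0 \<or> k = 1" "k = 1 \<Longrightarrow> t \<noteq> q"
  shows "arm k p t q = of_bool (p \<noteq> - q)"
proof (cases "p = - q")
  case True
  then show ?thesis using arm_eq(2)[OF assms(1,4), of k] by simp
next
  case False
  then have "perp q p"
    using assms perp_sym[of q p] by (simp add: perp_def)
  then have "q = t \<or> q = - t" using perp_eq assms(1,4) by blast
  then show ?thesis using arm_eq(3,4)[OF assms(1,4), of k] assms(5,6) False by auto
qed

section \<open>Edges and squares at a lattice vertex\<close>

lemma card_filter_of_bool: "finite A \<Longrightarrow> card {a \<in> A. P a} = (\<Sum>a\<in>A. of_bool (P a))"
  by (simp add: sum.inter_filter[symmetric] of_bool_def)

lemma edge_horizontal: "{(a, b), (a + 1, b)} \<in> edges C \<longleftrightarrow> (a, b) \<in> C \<or> (a, b - 1) \<in> C"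
proof
  assume "{(a, b), (a + 1, b)} \<in> edges C"
  then obtain s where "s \<in> C" "{(a, b), (a + 1, b)} \<in> sides s" by (auto simp: edges_def)
  then show "(a, b) \<in> C \<or> (a, b - 1) \<in> C"
    by (cases s) (auto simp: doubleton_eq_iff)
qed (force simp: edges_def)

lemma edge_vertical: "{(a, b), (a, b + 1)} \<in> edges C \<longleftrightarrow> (a, b) \<in> C \<or> (a - 1, b) \<in> C"
proof
  assume "{(a, b), (a, b + 1)} \<in> edges C"
  then obtain s where "s \<in> C" "{(a, b), (a, b + 1)} \<in> sides s" by (auto simp: edges_def)
  then show "(a, b) \<in> C \<or> (a - 1, b) \<in> C"
    by (cases s) (auto simp: doubleton_eq_iff)
qed (force simp: edges_def)

text \<open>The unsimplified \<open>a - 1 + 1\<close> and \<open>b - 1 + 1\<close> keep the shape to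
  which \<open>edge_horizontal\<close> and \<open>edge_vertical\<close> apply.\<close>

lemma side_at:
  assumes "e \<in> sides s" "(a, b) \<in> e"
  shows "e \<in> {{(a, b), (a + 1, b)}, {(a - 1, b), (a - 1 + 1, b)},
    {(a, b), (a, b + 1)}, {(a, b - 1), (a, b - 1 + 1)}}"
proof -
  obtain c d where s: "s = (c, d)" by (cases s)
  have "(a, b) \<in> corners s" using assms by (auto simp: corners_def)
  then have "(c = a \<or> c = a - 1) \<and> (d = b \<or> d = b - 1)" by (auto simp: s corners_Pair)
  then consider "c = a" "d = b" | "c = a" "d = b - 1" | "c = a - 1" "d = b" | "c = a - 1" "d = b - 1"
    by blast
  then show ?thesis using assms by cases (simp_all add: s, (elim disjE; simp)+)
qed

text \<open>Each of the four lattice edges at the vertex is present exactly when one of the two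
  squares flanking it is.\<close>

lemma vdegree_edges:
  "vdegree (edges C) (a, b) =
    of_bool ((a, b) \<in> C \<or> (a, b - 1) \<in> C) + of_bool ((a - 1, b) \<in> C \<or> (a - 1, b - 1) \<in> C)
    + of_bool ((a, b) \<in> C \<or> (a - 1, b) \<in> C) + of_bool ((a, b - 1) \<in> C \<or> (a - 1, b - 1) \<in> C)"
proof -
  define E where "E = {{(a, b), (a + 1, b)}, {(a - 1, b), (a - 1 + 1, b)},
    {(a, b), (a, b + 1)}, {(a, b - 1), (a, b - 1 + 1)}}"
  have "e \<in> E" if e: "e \<in> edges C" "(a, b) \<in> e" for e
  proof -
    obtain s where "e \<in> sides s" using e by (auto simp: edges_def)
    then show ?thesis using e(2) unfolding E_def by (rule side_at)
  qed
  moreover have "(a, b) \<in> e" if "e \<in> E" for e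
    using that unfolding E_def by (elim insertE emptyE) simp_all
  ultimately have "{e \<in> edges C. (a, b) \<in> e} = {e \<in> E. e \<in> edges C}" by blast
  moreover have "finite E" by (simp add: E_def)
  ultimately have "vdegree (edges C) (a, b) = (\<Sum>e\<in>E. of_bool (e \<in> edges C))"
    unfolding vdegree_def by (simp only: card_filter_of_bool)
  also have "\<dots> = of_bool ({(a, b), (a + 1, b)} \<in> edges C)
    + (of_bool ({(a - 1, b), (a - 1 + 1, b)} \<in> edges C)
    + (of_bool ({(a, b), (a, b + 1)} \<in> edges C)
    + of_bool ({(a, b - 1), (a, b - 1 + 1)} \<in> edges C)))"
  proof -
    have "{(a, b), (a + 1, b)} \<notin> {{(a - 1, b), (a - 1 + 1, b)}, {(a, b), (a, b + 1)}, {(a, b - 1), (a, b - 1 + 1)}}"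
      "{(a - 1, b), (a - 1 + 1, b)} \<notin> {{(a, b), (a, b + 1)}, {(a, b - 1), (a, b - 1 + 1)}}"
      "{(a, b), (a, b + 1)} \<notin> {{(a, b - 1), (a, b - 1 + 1)}}"
      by (simp_all add: doubleton_eq_iff)
    then show ?thesis
      unfolding E_def by (simp only: sum.insert finite.intros empty_iff not_False_eq_True sum.empty add_0_right)
  qed
  finally show ?thesis by (simp only: edge_horizontal edge_vertical add.assoc)
qed

lemma card_squares_at:
  "card {s \<in> C. (a, b) \<in> corners s} =
    of_bool ((a, b) \<in> C) + of_bool ((a, b - 1) \<in> C) + of_bool ((a - 1, b) \<in> C)
    + of_bool ((a - 1, b - 1) \<in> C)"
proof -
  let ?S = "{(a, b), (a, b - 1), (a - 1, b), (a - 1, b - 1)}"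
  have "{s \<in> C. (a, b) \<in> corners s} = {s \<in> ?S. s \<in> C}" by (auto simp: corners_Pair)
  then have "card {s \<in> C. (a, b) \<in> corners s} = (\<Sum>s\<in>?S. of_bool (s \<in> C))"
    by (simp only: card_filter_of_bool finite.intros)
  then show ?thesis by simp
qed

section \<open>Degree sums in a chain\<close>

lemma of_bool_eq_oneD: "of_bool b = (1 :: nat) \<Longrightarrow> b"
  by (cases b) simp_all

lemma of_bool_cases: "of_bool b = (0 :: nat) \<or> of_bool b = (1 :: nat)"
  by simp

locale square_path =
  fixes x :: "nat \<Rightarrow> square" and n :: nat
  assumes inj: "inj_on x {..<n}"
    and adj: "i < n \<Longrightarrow> j < n \<Longrightarrow> adjacent (x i) (x j) \<longleftrightarrow> j = i + 1 \<or> i = j + 1"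
    and sys: "polyomino_system (x ` {..<n})"
begin

abbreviation "C \<equiv> x ` {..<n}"

text \<open>The counterpart of \<open>kink\<close> in terms of positions. The guards make it false
  at the two ends of the chain.\<close>

definition bend :: "nat \<Rightarrow> bool" where
  "bend i \<longleftrightarrow> 0 < i \<and> i + 1 < n \<and> x (i + 1) - x i \<noteq> x i - x (i - 1)"

lemma x_eq_iff: "i < n \<Longrightarrow> j < n \<Longrightarrow> x i = x j \<longleftrightarrow> i = j"
  using inj by (auto dest: inj_onD)

lemma step_dir: "i + 1 < n \<Longrightarrow> x (i + 1) - x i \<in> shift_dirs"
  using adj[of i "i + 1"] by (simp add: adjacent_iff)

lemma third_square:
  assumes "i < n" "j < n" "i \<noteq> j" "j \<noteq> i + 1" "i \<noteq> j + 1" "v \<in> corners (x i)" "v \<in> corners (x j)"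
  obtains m where "m < n" "m \<noteq> i" "m \<noteq> j" "v \<in> corners (x m)"
proof -
  have *: "\<exists>m<n. m \<noteq> i \<and> m \<noteq> j \<and> v \<in> corners (x m)"
    if "i < j" "j < n" "j \<noteq> i + 1" "v \<in> corners (x i)" "v \<in> corners (x j)" for i j
    using no_pinch[OF sys adj, of i j v] that x_eq_iff[of i j] adj[of i j] by auto
  show thesis
    using *[of i j] *[of j i] assms that by (metis linorder_neqE_nat)
qed

text \<open>Four squares around a vertex form a cycle under adjacency, while adjacent squares have
  consecutive positions in a path, which contains no cycle.\<close>

lemma not_four:
  assumes "(a, b) \<in> C" "(a, b - 1) \<in> C" "(a - 1, b) \<in> C" "(a - 1, b - 1) \<in> C"
  shows False
proof -
  obtain i j k l where i: "i < n" "(a, b) = x i" and j: "j < n" "(a, b - 1) = x j"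
    and k: "k < n" "(a - 1, b) = x k" and l: "l < n" "(a - 1, b - 1) = x l"
    using assms by (elim imageE) (simp only: lessThan_iff)
  have "adjacent (a, b) (a, b - 1)" "adjacent (a, b) (a - 1, b)"
    "adjacent (a, b - 1) (a - 1, b - 1)" "adjacent (a - 1, b) (a - 1, b - 1)"
    by (simp_all add: adjacent_iff shift_dirs_def)
  then have "j = i + 1 \<or> i = j + 1" "k = i + 1 \<or> i = k + 1" "l = j + 1 \<or> j = l + 1" "l = k + 1 \<or> k = l + 1"
    unfolding i(2) j(2) k(2) l(2) using adj i(1) j(1) k(1) l(1) by blast+
  moreover have "(a, b) \<noteq> (a - 1, b - 1)" "(a, b - 1) \<noteq> (a - 1, b)" by simp_all
  then have "i \<noteq> l" "j \<noteq> k" unfolding i(2) j(2) k(2) l(2) by auto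
  ultimately show False by auto
qed

lemma diagonal_filled:
  assumes "s \<in> C" "t \<in> C" "s \<noteq> t" "\<not> adjacent s t" "v \<in> corners s" "v \<in> corners t"
  shows "\<exists>r\<in>C. r \<noteq> s \<and> r \<noteq> t \<and> v \<in> corners r"
proof -
  obtain i j where ij: "i < n" "s = x i" "j < n" "t = x j" using assms(1,2) by auto
  then obtain m where "m < n" "m \<noteq> i" "m \<noteq> j" "v \<in> corners (x m)"
    using third_square[of i j v] assms adj[of i j] by metis
  then show ?thesis using ij x_eq_iff by auto
qed

text \<open>Around the vertex the squares of the chain fill one, two or three consecutive quadrants,
  bounded and separated by one edge more than there are squares. The exceptional patterns, a
  diagonal pair and all four quadrants, are excluded by \<open>diagonal_filled\<close> and
  \<open>not_four\<close>.\<close>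

lemma vdegree_eq:
  assumes "s \<in> C" "v \<in> corners s"
  shows "vdegree (edges C) v = 1 + card {s \<in> C. v \<in> corners s}"
proof -
  obtain a b where v: "v = (a, b)" by (cases v)
  have at: "r \<in> {(a, b), (a, b - 1), (a - 1, b), (a - 1, b - 1)}" if "v \<in> corners r" for r
    using that by (cases r) (auto simp: v corners_Pair)
  have vc: "v \<in> corners (a, b)" "v \<in> corners (a, b - 1)" "v \<in> corners (a - 1, b)"
    "v \<in> corners (a - 1, b - 1)"
    by (auto simp: v corners_Pair)
  have "(a, b - 1) \<in> C \<or> (a - 1, b) \<in> C" if h: "(a, b) \<in> C" "(a - 1, b - 1) \<in> C"
  proof -
    have "\<not> adjacent (a, b) (a - 1, b - 1)" by (simp add: adjacent_iff shift_dirs_def)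
    moreover have "(a, b) \<noteq> (a - 1, b - 1)" by simp
    ultimately obtain r where "r \<in> C" "r \<noteq> (a, b)" "r \<noteq> (a - 1, b - 1)" "v \<in> corners r"
      using diagonal_filled[OF h _ _ vc(1,4)] by blast
    then show ?thesis using at[of r] unfolding insert_iff empty_iff by metis
  qed
  moreover have "(a, b) \<in> C \<or> (a - 1, b - 1) \<in> C" if h: "(a, b - 1) \<in> C" "(a - 1, b) \<in> C"
  proof -
    have "\<not> adjacent (a, b - 1) (a - 1, b)" by (simp add: adjacent_iff shift_dirs_def)
    moreover have "(a, b - 1) \<noteq> (a - 1, b)" by simp
    ultimately obtain r where "r \<in> C" "r \<noteq> (a, b - 1)" "r \<noteq> (a - 1, b)" "v \<in> corners r"
      using diagonal_filled[OF h _ _ vc(2,3)] by blast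
    then show ?thesis using at[of r] unfolding insert_iff empty_iff by metis
  qed
  moreover note not_four[of a b]
  moreover have "(a, b) \<in> C \<or> (a, b - 1) \<in> C \<or> (a - 1, b) \<in> C \<or> (a - 1, b - 1) \<in> C"
    using at[OF assms(2)] assms(1) unfolding insert_iff empty_iff by metis
  ultimately show ?thesis
    unfolding v vdegree_edges card_squares_at
    by (cases "(a, b) \<in> C"; cases "(a, b - 1) \<in> C"; cases "(a - 1, b) \<in> C"; cases "(a - 1, b - 1) \<in> C")
      (simp_all only: of_bool_def if_True if_False simp_thms, simp_all)
qed

lemma card_squares_index:
  "card {s \<in> C. v \<in> corners s} = (\<Sum>j<n. of_bool (v \<in> corners (x j)))"
proof -
  have "{s \<in> C. v \<in> corners s} = x ` {j \<in> {..<n}. v \<in> corners (x j)}" by blast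
  moreover have "inj_on x {j \<in> {..<n}. v \<in> corners (x j)}"
    using inj by (rule inj_on_subset) blast
  ultimately have "card {s \<in> C. v \<in> corners s} = card {j \<in> {..<n}. v \<in> corners (x j)}"
    by (simp only: card_image)
  then show ?thesis by (simp only: card_filter_of_bool finite_lessThan)
qed

text \<open>Squares further apart that share a corner lie diagonally across it, so the third square
  there is adjacent to both of them. Its position then differs by 1 from both positions, which
  brings them within distance 2.\<close>

lemma corner_window:
  assumes "i < n" "j < n" "v \<in> corners (x i)" "v \<in> corners (x j)"
  shows "j \<le> i + 2 \<and> i \<le> j + 2"
proof (rule ccontr)
  assume far: "\<not> ?thesis"
  then obtain m where m: "m < n" "m \<noteq> i" "m \<noteq> j" "v \<in> corners (x m)"
    using third_square[of i j v] assms by (metis add_leD1 add_mono_thms_linordered_semiring(1) le_add1 le_refl one_le_numeral trans_le_add1)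
  have "adjacent s t"
    if "v \<in> corners s" "v \<in> corners t" "v \<in> corners r" "\<not> adjacent s r" "s \<noteq> r" "s \<noteq> t" "t \<noteq> r" for s t r
  proof -
    obtain a b c d e f p q where st: "s = (a, b)" "t = (c, d)" "r = (e, f)" "v = (p, q)"
      by (metis surj_pair)
    have "a = p \<or> a = p - 1" "b = q \<or> b = q - 1" "c = p \<or> c = p - 1" "d = q \<or> d = q - 1"
      "e = p \<or> e = p - 1" "f = q \<or> f = q - 1"
      using that(1-3) by (auto simp: st corners_Pair)
    then show ?thesis using that(4-7) unfolding st adjacent_iff shift_dirs_def
      by (elim disjE) simp_all
  qed
  note * = this
  have ne: "x i \<noteq> x j" "x i \<noteq> x m" "x j \<noteq> x m" "x m \<noteq> x j" "x m \<noteq> x i" "x j \<noteq> x i"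
    using x_eq_iff assms(1,2) m(1-3) far by auto
  have "\<not> adjacent (x i) (x j)" "\<not> adjacent (x j) (x i)"
    using adj assms(1,2) far by auto
  then have "adjacent (x i) (x m)" "adjacent (x j) (x m)"
    using *[OF assms(3) m(4) assms(4)] *[OF assms(4) m(4) assms(3)] ne by blast+
  then show False using adj[of i m] adj[of j m] m assms far by auto
qed

section \<open>Degree sums of sides from the preceding and following squares\<close>

definition deg_sum :: "corner set \<Rightarrow> nat" where
  "deg_sum e = (\<Sum>v\<in>e. vdegree (edges C) v)"

lemma finite_side: "u \<in> shift_dirs \<Longrightarrow> finite (shared_side s u)"
  using card_shared_side[of u s] card.infinite by fastforce

text \<open>Each of the two ends of the side contributes 1 for the excess of degree over squares and
  1 for \<open>x i\<close> itself, which gives the constant 4.\<close>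

lemma deg_sum_eq:
  assumes "i < n" "u \<in> shift_dirs"
  shows "deg_sum (shared_side (x i) u) =
    4 + (\<Sum>j<i. card (shared_side (x i) u \<inter> corners (x j)))
      + (\<Sum>j\<in>{i+1..<n}. card (shared_side (x i) u \<inter> corners (x j)))"
proof -
  let ?e = "shared_side (x i) u"
  have sub: "v \<in> corners (x i)" if "v \<in> ?e" for v using that by (simp add: shared_side_def)
  have "deg_sum ?e = (\<Sum>v\<in>?e. 1 + (\<Sum>j<n. of_bool (v \<in> corners (x j))))"
    unfolding deg_sum_def
  proof (rule sum.cong[OF refl])
    fix v assume "v \<in> ?e"
    then show "vdegree (edges C) v = 1 + (\<Sum>j<n. of_bool (v \<in> corners (x j)))"
      using vdegree_eq[of "x i" v] sub assms(1) card_squares_index by simp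
  qed
  also have "\<dots> = 2 + (\<Sum>j<n. \<Sum>v\<in>?e. of_bool (v \<in> corners (x j)))"
    by (simp only: sum.distrib sum_constant card_shared_side[OF assms(2)] of_nat_id mult_1_right
        sum.swap[of "\<lambda>v j. of_bool (v \<in> corners (x j))" "{..<n}" ?e])
  also have "(\<lambda>j. \<Sum>v\<in>?e. of_bool (v \<in> corners (x j))) = (\<lambda>j. card (?e \<inter> corners (x j)))"
    using card_filter_of_bool[OF finite_side[OF assms(2)]] by (simp add: Int_def fun_eq_iff)
  also have "{..<n} = insert i ({..<i} \<union> {i+1..<n})" using assms(1) by auto
  also have "(\<Sum>j\<in>\<dots>. card (?e \<inter> corners (x j))) = card (?e \<inter> corners (x i))
      + ((\<Sum>j<i. card (?e \<inter> corners (x j))) + (\<Sum>j\<in>{i+1..<n}. card (?e \<inter> corners (x j))))"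
    by (subst sum.insert) (auto intro!: sum.union_disjoint)
  also have "?e \<inter> corners (x i) = ?e" using sub by auto
  finally show ?thesis using card_shared_side[OF assms(2)] by simp
qed

text \<open>Without a bend the turn is an arbitrary perpendicular step, which the factor \<open>k = 0\<close> discards.\<close>

definition turn_fwd :: "nat \<Rightarrow> square" where
  "turn_fwd i = (if bend (i + 1) then x (i + 2) - x (i + 1) else (SOME t. perp t (x (i + 1) - x i)))"

definition turn_bwd :: "nat \<Rightarrow> square" where
  "turn_bwd i = (if bend (i - 1) then x (i - 2) - x (i - 1) else (SOME t. perp t (x (i - 1) - x i)))"

lemma ex_perp: "q \<in> shift_dirs \<Longrightarrow> \<exists>t. perp t q"
  \<comment> \<open>Exchanging the coordinates of a unit step gives a perpendicular one.\<close>
  by (rule exI[of _ "(snd q, fst q)"]) (auto simp: shift_dirs_def perp_def)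

lemma perp_turn_fwd:
  assumes "i + 1 < n"
  shows "perp (turn_fwd i) (x (i + 1) - x i)"
proof (cases "bend (i + 1)")
  case True
  then have i2: "i + 2 < n" by (simp add: bend_def)
  then have "x (i + 2) \<noteq> x i" using x_eq_iff by simp
  moreover have "x (i + 2) - x (i + 1) \<in> shift_dirs" using step_dir[of "i + 1"] i2 by simp
  ultimately show ?thesis using True by (auto simp: turn_fwd_def perp_def bend_def)
next
  case False
  then show ?thesis
    using someI_ex[OF ex_perp[OF step_dir[OF assms]]] by (simp add: turn_fwd_def)
qed

lemma back_dir: "0 < i \<Longrightarrow> i < n \<Longrightarrow> x (i - 1) - x i \<in> shift_dirs"
  using adj[of i "i - 1"] by (simp add: adjacent_iff)

lemma perp_turn_bwd:
  assumes "0 < i" "i < n"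
  shows "perp (turn_bwd i) (x (i - 1) - x i)"
proof (cases "bend (i - 1)")
  case True
  \<comment> \<open>A bend at \<open>i - 1\<close> forces \<open>0 < i - 1\<close>, so none of the
    subtractions is truncated.\<close>
  then obtain m where i: "i = m + 2" by (metis add_2_eq_Suc' bend_def less_diff_conv less_imp_Suc_add add_cancel_right_left Suc_1 plus_1_eq_Suc add.commute add_Suc_right)
  then have "x (m + 2) \<noteq> x m" using x_eq_iff assms by simp
  moreover have "x m - x (m + 1) \<in> shift_dirs" using back_dir[of "m + 1"] i assms by simp
  moreover have "x m - x (m + 1) \<noteq> x (m + 1) - x (m + 2)"
    using True i by (auto simp: bend_def algebra_simps)
  ultimately show ?thesis using True i by (auto simp: turn_bwd_def perp_def)
next
  case False
  then show ?thesis
    using someI_ex[OF ex_perp[OF back_dir[OF assms]]] by (simp add: turn_bwd_def)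
qed

text \<open>By \<open>corner_window\<close> only the next two squares can touch \<open>x i\<close>,
  and by \<open>straight_overlap\<close> the second of them matters only if the first is a
  bend.\<close>

lemma fwd_arm:
  assumes "i + 1 < n" "u \<in> shift_dirs"
  shows "(\<Sum>j\<in>{i+1..<n}. card (shared_side (x i) u \<inter> corners (x j)))
    = arm (of_bool (bend (i + 1))) (x (i + 1) - x i) (turn_fwd i) u"
proof -
  let ?g = "\<lambda>j. card (shared_side (x i) u \<inter> corners (x j))"
  have g: "?g j = side_overlap u (x j - x i)" for j
    using card_shared_side_corners[of "x i" u "x j - x i"] by simp
  have far: "?g j = 0" if "j \<in> {i+1..<n} - {i + 1, i + 2}" for j
  proof -
    have "\<not> v \<in> corners (x j)" if "v \<in> shared_side (x i) u" for v
      using corner_window[of i j v] that \<open>j \<in> _\<close> by (auto simp: shared_side_def)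
    then have "shared_side (x i) u \<inter> corners (x j) = {}" by blast
    then show ?thesis by simp
  qed
  have "sum ?g {i+1..<n} = sum ?g ({i+1..<n} \<inter> {i + 1, i + 2})"
    using far by (intro sum.mono_neutral_right) auto
  also have "\<dots> = ?g (i + 1) + (if i + 2 < n then ?g (i + 2) else 0)"
    using assms(1) by (simp add: Int_insert_right)
  also have "(if i + 2 < n then ?g (i + 2) else 0)
      = of_bool (bend (i + 1)) * side_overlap u (x (i + 1) - x i + turn_fwd i)"
  proof (cases "i + 2 < n")
    case True
    show ?thesis
    proof (cases "bend (i + 1)")
      case True
      then show ?thesis using \<open>i + 2 < n\<close> by (simp add: g turn_fwd_def)
    next
      case False
      then have "x (i + 2) - x (i + 1) = x (i + 1) - x i"
        using True by (simp add: bend_def)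
      then have "x (i + 2) - x i = (x (i + 1) - x i) + (x (i + 1) - x i)"
        by (metis diff_add_cancel add_diff_eq)
      then have "?g (i + 2) = 0"
        unfolding g by (simp only: straight_overlap[OF assms(2) step_dir[OF assms(1)]])
      then show ?thesis using False by simp
    qed
  next
    case False
    then show ?thesis by (simp add: bend_def)
  qed
  finally show ?thesis by (simp add: arm_def g)
qed

lemma bwd_arm:
  assumes "0 < i" "i < n" "u \<in> shift_dirs"
  shows "(\<Sum>j<i. card (shared_side (x i) u \<inter> corners (x j)))
    = arm (of_bool (bend (i - 1))) (x (i - 1) - x i) (turn_bwd i) u"
proof -
  let ?g = "\<lambda>j. card (shared_side (x i) u \<inter> corners (x j))"
  have g: "?g j = side_overlap u (x j - x i)" for j
    using card_shared_side_corners[of "x i" u "x j - x i"] by simp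
  have far: "?g j = 0" if "j \<in> {..<i} - {i - 1, i - 2}" for j
  proof -
    have "\<not> v \<in> corners (x j)" if "v \<in> shared_side (x i) u" for v
      using corner_window[of i j v] that \<open>j \<in> _\<close> assms by (auto simp: shared_side_def)
    then have "shared_side (x i) u \<inter> corners (x j) = {}" by blast
    then show ?thesis by simp
  qed
  have "sum ?g {..<i} = sum ?g ({..<i} \<inter> {i - 1, i - 2})"
    using far by (intro sum.mono_neutral_right) auto
  \<comment> \<open>For \<open>i = 1\<close> both \<open>i - 1\<close> and \<open>i - 2\<close> are
    0, and the square must not be counted twice.\<close>
  also have "\<dots> = ?g (i - 1) + (if 1 < i then ?g (i - 2) else 0)"
    using assms(1) by (cases "i = 1") (auto simp: Int_insert_right)
  also have "(if 1 < i then ?g (i - 2) else 0)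
      = of_bool (bend (i - 1)) * side_overlap u (x (i - 1) - x i + turn_bwd i)"
  proof (cases "1 < i")
    case True
    then obtain m where m: "i = m + 2" by (metis add.commute add_2_eq_Suc less_imp_Suc_add add_Suc_right One_nat_def Suc_1 plus_1_eq_Suc add_Suc)
    show ?thesis
    proof (cases "bend (i - 1)")
      case True
      moreover have "?g (i - 2) = side_overlap u (x (i - 1) - x i + (x (i - 2) - x (i - 1)))"
        unfolding g by simp
      ultimately show ?thesis using \<open>1 < i\<close> by (simp add: turn_bwd_def)
    next
      case False
      then have "x (m + 2) - x (m + 1) = x (m + 1) - x m"
        using m assms(2) by (simp add: bend_def)
      then have "x m - x i = (x (m + 1) - x i) + (x (m + 1) - x i)"
        unfolding m by (simp add: algebra_simps)
      moreover have "i - 2 = m" "i - 1 = m + 1" using m by simp_all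
      ultimately have "x (i - 2) - x i = (x (i - 1) - x i) + (x (i - 1) - x i)" by simp
      then have "?g (i - 2) = 0"
        unfolding g by (simp only: straight_overlap[OF assms(3) back_dir[OF assms(1,2)]])
      then show ?thesis using False by simp
    qed
  next
    case False
    then show ?thesis using assms by (simp add: bend_def)
  qed
  finally show ?thesis by (simp add: arm_def g)
qed


lemma not_touching:
  assumes "i + 3 < n"
  shows "x (i + 3) - x i \<notin> shift_dirs"
  using adj[of i "i + 3"] assms by (simp add: adjacent_iff)

lemma bend_iff:
  assumes "0 < i" "i + 1 < n"
  shows "bend i \<longleftrightarrow> x (i - 1) - x i \<noteq> - (x (i + 1) - x i)"
  using assms by (auto simp: bend_def algebra_simps)

text \<open>Otherwise the squares at positions \<open>i - 2\<close> and \<open>i + 1\<close> would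
  differ by a unit step and close up to a block of four.\<close>

lemma turn_bwd_neq:
  assumes "bend (i - 1)" "i + 1 < n"
  shows "turn_bwd i \<noteq> x (i + 1) - x i"
proof
  assume eq: "turn_bwd i = x (i + 1) - x i"
  obtain m where i: "i = m + 2"
    using assms(1) by (metis bend_def nat_le_iff_add Suc_leI add.commute Suc_1 less_diff_conv plus_1_eq_Suc add_Suc)
  have "x (m + 3) - x m = x (m + 2) - x (m + 1)"
    using eq assms(1) i by (simp add: turn_bwd_def algebra_simps numeral_3_eq_3)
  then show False using not_touching[of m] step_dir[of "m + 1"] assms(2) i by simp
qed

lemma turn_fwd_neq:
  assumes "bend (i + 1)" "0 < i"
  shows "turn_fwd i \<noteq> x (i - 1) - x i"
proof
  assume eq: "turn_fwd i = x (i - 1) - x i"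
  obtain m where i: "i = m + 1" using assms(2) by (metis Suc_eq_plus1 gr0_implies_Suc)
  have n: "m + 3 < n" using assms(1) i by (simp add: bend_def)
  have "x (m + 3) - x m = x (m + 2) - x (m + 1)"
    using eq assms(1) i by (simp add: turn_fwd_def algebra_simps numeral_3_eq_3)
  then show False using not_touching[of m] step_dir[of "m + 1"] n by simp
qed

text \<open>Both ends of the side lie on the two squares sharing it, which gives 6. If one of these
  squares is a bend, its other neighbour touches the side in one further corner.\<close>

lemma deg_sum_shared:
  assumes "i + 1 < n"
  shows "deg_sum (shared_side (x i) (x (i + 1) - x i)) = 6 + of_bool (bend i) + of_bool (bend (i + 1))"
proof -
  let ?q = "x (i + 1) - x i"
  note q = step_dir[OF assms]
  have fwd: "(\<Sum>j\<in>{i+1..<n}. card (shared_side (x i) ?q \<inter> corners (x j))) = 2 + of_bool (bend (i + 1))"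
    using fwd_arm[OF assms q] arm_eq(1)[OF q perp_turn_fwd[OF assms]] by simp
  have "(\<Sum>j<i. card (shared_side (x i) ?q \<inter> corners (x j))) = of_bool (bend i)"
  proof (cases "i = 0")
    case True
    then show ?thesis by (simp add: bend_def)
  next
    case False
    then have i: "0 < i" "i < n" using assms by auto
    have "x (i - 1) \<noteq> x (i + 1)" using x_eq_iff[of "i - 1" "i + 1"] assms i by simp
    then have ne: "x (i - 1) - x i \<noteq> ?q" by auto
    have "arm (of_bool (bend (i - 1))) (x (i - 1) - x i) (turn_bwd i) ?q
        = of_bool (x (i - 1) - x i \<noteq> - ?q)"
      using of_bool_cases turn_bwd_neq[OF of_bool_eq_oneD assms]
      by (rule arm_across[OF back_dir[OF i] q ne perp_turn_bwd[OF i]])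
    then show ?thesis using bwd_arm[OF i q] bend_iff[OF i(1) assms] by simp
  qed
  then show ?thesis using deg_sum_eq[OF _ q] fwd assms by simp
qed

lemma sum_first_cell:
  fixes f :: "nat \<Rightarrow> real"
  assumes "1 < n"
  shows "(\<Sum>e\<in>sides (x 0). f (deg_sum e)) =
    f 4 + f 5 + (f (5 + of_bool (bend 1)) + f (6 + of_bool (bend 1)))"
proof -
  have "(\<Sum>e\<in>sides (x 0). f (deg_sum e))
      = (\<Sum>u\<in>shift_dirs. f (4 + arm (of_bool (bend (0 + 1))) (x (0 + 1) - x 0) (turn_fwd 0) u))"
    unfolding sum_sides
    by (rule sum.cong[OF refl]) (use deg_sum_eq[of 0] fwd_arm[of 0] assms in simp)
  then show ?thesis
    using sum_end_cell[OF step_dir[of 0] perp_turn_fwd[of 0]] assms by simp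
qed

lemma sum_last_cell:
  fixes f :: "nat \<Rightarrow> real"
  assumes "0 < i" "i + 1 = n"
  shows "(\<Sum>e\<in>sides (x i). f (deg_sum e)) =
    f 4 + f 5 + (f (5 + of_bool (bend (i - 1))) + f (6 + of_bool (bend (i - 1))))"
proof -
  have i: "i < n" using assms by simp
  have "(\<Sum>e\<in>sides (x i). f (deg_sum e))
      = (\<Sum>u\<in>shift_dirs. f (4 + arm (of_bool (bend (i - 1))) (x (i - 1) - x i) (turn_bwd i) u))"
    unfolding sum_sides
    by (rule sum.cong[OF refl]) (use deg_sum_eq[OF i] bwd_arm[OF assms(1) i] assms in simp)
  then show ?thesis
    using sum_end_cell[OF back_dir[OF assms(1) i] perp_turn_bwd[OF assms(1) i]] by simp
qed

text \<open>For a straight square between two bends, \<open>no_U\<close> says that the chain turns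
  to opposite sides before and after it.\<close>

lemma sum_middle_cell:
  fixes f :: "nat \<Rightarrow> real"
  assumes i: "0 < i" "i + 1 < n"
    and no_U: "\<not> bend i \<Longrightarrow> bend (i - 1) \<Longrightarrow> bend (i + 1) \<Longrightarrow> x (i - 2) - x (i - 1) \<noteq> x (i + 2) - x (i + 1)"
  shows "(\<Sum>e\<in>sides (x i). f (deg_sum e)) =
    cell_share f (of_bool (bend i)) (of_bool (bend (i - 1)))
    + cell_share f (of_bool (bend i)) (of_bool (bend (i + 1)))"
proof -
  have i': "i < n" using i by simp
  note b = bend_iff[OF i]
  have "x (i - 1) \<noteq> x (i + 1)" using x_eq_iff[of "i - 1" "i + 1"] i by simp
  then have ne: "x (i - 1) - x i \<noteq> x (i + 1) - x i" by auto
  have "(\<Sum>e\<in>sides (x i). f (deg_sum e))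
      = (\<Sum>u\<in>shift_dirs. f (4 + arm (of_bool (bend (i - 1))) (x (i - 1) - x i) (turn_bwd i) u
          + arm (of_bool (bend (i + 1))) (x (i + 1) - x i) (turn_fwd i) u))"
    unfolding sum_sides
    by (rule sum.cong[OF refl])
      (use deg_sum_eq[OF i'] bwd_arm[OF i(1) i'] fwd_arm[OF i(2)] in simp)
  also have "\<dots> = cell_share f (of_bool (x (i - 1) - x i \<noteq> - (x (i + 1) - x i))) (of_bool (bend (i - 1)))
    + cell_share f (of_bool (x (i - 1) - x i \<noteq> - (x (i + 1) - x i))) (of_bool (bend (i + 1)))"
  proof (rule sum_inner_cell[OF back_dir[OF i(1) i'] step_dir[OF i(2)] ne
        perp_turn_bwd[OF i(1) i'] perp_turn_fwd[OF i(2)]])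
    assume k: "of_bool (bend (i - 1)) = (1 :: nat)"
    then have kb: "bend (i - 1)" by (rule of_bool_eq_oneD)
    then show "turn_bwd i \<noteq> x (i + 1) - x i" using turn_bwd_neq i by blast
    assume "of_bool (bend (i + 1)) = (1 :: nat)" and p: "x (i - 1) - x i = - (x (i + 1) - x i)"
    from this(1) have "bend (i + 1)" by (rule of_bool_eq_oneD)
    then show "turn_bwd i \<noteq> turn_fwd i"
      using no_U kb p b by (simp add: turn_bwd_def turn_fwd_def)
  next
    assume k: "of_bool (bend (i + 1)) = (1 :: nat)"
    then have "bend (i + 1)" by (rule of_bool_eq_oneD)
    then show "turn_fwd i \<noteq> x (i - 1) - x i" using turn_fwd_neq i by blast
  qed (rule of_bool_cases)+
  finally show ?thesis unfolding b .
qed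

text \<open>Each new square meets the earlier ones in exactly one side, the one shared with its
  predecessor. That side is counted twice in the sum over squares.\<close>

lemma sum_edges_prefix:
  fixes g :: "corner set \<Rightarrow> real"
  assumes "m < n"
  shows "(\<Sum>e\<in>edges (x ` {..<Suc m}). g e) =
    (\<Sum>i<Suc m. \<Sum>e\<in>sides (x i). g e) - (\<Sum>i<m. g (shared_side (x i) (x (i + 1) - x i)))"
  using assms
proof (induction m)
  case 0
  then show ?case by (simp add: edges_def lessThan_Suc)
next
  case (Suc m)
  let ?E = "edges (x ` {..<Suc m})"
  have fin: "finite (sides s)" for s by (cases s) simp
  have E: "edges (x ` {..<Suc (Suc m)}) = ?E \<union> sides (x (Suc m))"
    by (auto simp: edges_def lessThan_Suc)
  have step: "x (Suc m) - x m \<in> shift_dirs" using step_dir[of m] Suc.prems by simp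
  have "?E \<inter> sides (x (Suc m)) = sides (x m) \<inter> sides (x (Suc m))"
  proof -
    have "sides (x i) \<inter> sides (x (Suc m)) = {}" if "i < m" for i
    proof -
      have "\<not> adjacent (x i) (x (Suc m))" "x i \<noteq> x (Suc m)"
        using adj[of i "Suc m"] x_eq_iff[of i "Suc m"] that Suc.prems by auto
      then show ?thesis by (simp add: adjacent_def)
    qed
    then show ?thesis unfolding edges_def lessThan_Suc by blast
  qed
  also have "\<dots> = {shared_side (x m) (x (Suc m) - x m)}"
    using sides_Int_sides[OF step, of "x m"] by simp
  finally have "?E \<inter> sides (x (Suc m)) = {shared_side (x m) (x (Suc m) - x m)}" .
  moreover have "finite ?E" unfolding edges_def using fin by auto
  ultimately have "(\<Sum>e\<in>edges (x ` {..<Suc (Suc m)}). g e)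
      = (\<Sum>e\<in>?E. g e) + (\<Sum>e\<in>sides (x (Suc m)). g e) - g (shared_side (x m) (x (Suc m) - x m))"
    unfolding E using sum_Un[of ?E "sides (x (Suc m))" g] fin by simp
  then show ?case using Suc by simp
qed

end

section \<open>Segments\<close>

lemma adjacent_neq: "adjacent s t \<Longrightarrow> s \<noteq> t"
  by (simp add: adjacent_def)

lemma adjacent_commute: "adjacent s t \<longleftrightarrow> adjacent t s"
  by (auto simp: adjacent_def)

lemma adjacent_add: "adjacent s (s + d) \<longleftrightarrow> d \<in> shift_dirs"
  by (simp add: adjacent_iff)

lemma shift_dirs_cases:
  assumes "d \<in> shift_dirs"
  obtains "d = (1, 0)" | "d = (- 1, 0)" | "d = (0, 1)" | "d = (0, - 1)"
  using assms by (auto simp: shift_dirs_def)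

lemma star_connected:
  assumes c: "c \<in> S" "\<And>t. t \<in> S \<Longrightarrow> t = c \<or> adjacent c t" and st: "s \<in> S" "t \<in> S"
  shows "(s, t) \<in> {(p, q). p \<in> S \<and> q \<in> S \<and> adjacent p q}\<^sup>*"
proof -
  let ?r = "{(p, q). p \<in> S \<and> q \<in> S \<and> adjacent p q}"
  have "(s, c) \<in> ?r\<^sup>*" "(c, t) \<in> ?r\<^sup>*"
    using c(2)[OF st(1)] c(2)[OF st(2)] st c(1) by (auto simp: adjacent_commute)
  then show ?thesis by (rule rtrancl_trans)
qed

lemma card_neighbours_le:
  assumes "finite S" "s \<in> S"
  shows "card (neighbours S s) \<le> card S - 1"
proof -
  have "neighbours S s \<subseteq> S - {s}" by (auto simp: neighbours_def adjacent_def)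
  then have "card (neighbours S s) \<le> card (S - {s})" using assms by (intro card_mono) auto
  then show ?thesis using assms by simp
qed

lemma convex_domino:
  assumes "d \<in> shift_dirs"
  shows "convex (cell s \<union> cell (s + d))"
proof -
  obtain a b where s: "s = (a, b)" by (cases s)
  from assms have "cell s \<union> cell (s + d)
    = {real_of_int (a + min 0 (fst d))..real_of_int (a + 1 + max 0 (fst d))}
      \<times> {real_of_int (b + min 0 (snd d))..real_of_int (b + 1 + max 0 (snd d))}"
    by (cases rule: shift_dirs_cases) (auto simp: s cell_Pair)
  then show ?thesis by (simp add: convex_Times convex_real_interval)
qed

lemma convex_triomino:
  assumes "d \<in> shift_dirs"
  shows "convex (cell s \<union> cell (s + d) \<union> cell (s - d))"
proof -
  obtain a b where s: "s = (a, b)" by (cases s)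
  from assms have "cell s \<union> cell (s + d) \<union> cell (s - d)
    = (if snd d = 0 then {real_of_int a - 1..real_of_int a + 2} \<times> {real_of_int b..real_of_int b + 1}
       else {real_of_int a..real_of_int a + 1} \<times> {real_of_int b - 1..real_of_int b + 2})"
    by (cases rule: shift_dirs_cases) (auto simp: s cell_Pair)
  then show ?thesis by (simp add: convex_Times convex_real_interval)
qed

lemma double_shift: "d \<in> shift_dirs \<Longrightarrow> d + d \<notin> shift_dirs \<and> d + d \<noteq> 0 \<and> d \<noteq> 0"
  by (elim shift_dirs_cases) (simp_all add: shift_dirs_def zero_prod_def)

lemma linear_chain_domino:
  assumes d: "d \<in> shift_dirs"
  shows "linear_chain {s, s + d}"
proof -
  let ?S = "{s, s + d}"
  have ne: "s \<noteq> s + d" using double_shift[OF d] by simp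
  have "polyomino_system ?S"
  proof (rule polyomino_system_convex)
    show "convex (\<Union>t\<in>?S. cell t)" using convex_domino[OF d] by simp
    show "(u, t) \<in> {(p, q). p \<in> ?S \<and> q \<in> ?S \<and> adjacent p q}\<^sup>*" if "u \<in> ?S" "t \<in> ?S" for u t
      using d that by (intro star_connected[of s]) (auto simp: adjacent_add)
  qed auto
  moreover have c: "card (neighbours ?S t) \<le> 1" if "t \<in> ?S" for t
    using card_neighbours_le[of ?S t] that ne by simp
  moreover have "\<exists>xs. distinct xs \<and> set xs = ?S \<and> (\<forall>i<length xs. \<forall>j<length xs.
      adjacent (xs ! i) (xs ! j) \<longleftrightarrow> j = i + 1 \<or> i = j + 1)"
    using d ne adjacent_neq[of s s] adjacent_neq[of "s + d" "s + d"] adjacent_commute[of "s + d" s]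
    by (intro exI[of _ "[s, s + d]"]) (auto simp: All_less_Suc numeral_2_eq_2 adjacent_add)
  moreover have "card (neighbours ?S t) \<le> 2" if "t \<in> ?S" for t using c[OF that] by simp
  moreover have "\<not> kink ?S t" if "t \<in> ?S" for t
    using c[OF that] by (simp add: kink_def non_terminal_def)
  ultimately show ?thesis
    unfolding linear_chain_def polyomino_chain_def by blast
qed

text \<open>The end squares have only one neighbour, and every corner of the middle square lies on
  exactly one end square and so has degree 3. Hence no square is a kink.\<close>

lemma linear_chain_triomino:
  assumes d: "d \<in> shift_dirs"
  shows "linear_chain {s, s + d, s - d}"
proof -
  let ?S = "{s, s + d, s - d}"
  have ne: "s \<noteq> s + d" "s \<noteq> s - d" "s + d \<noteq> s - d"
    using double_shift[OF d] by (auto simp: algebra_simps)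
  have a: "adjacent s (s + d)" "adjacent s (s - d)" "adjacent (s + d) s" "adjacent (s - d) s"
    using d uminus_shift_dirs[OF d] by (auto simp: adjacent_iff)
  have na: "\<not> adjacent (s - d) (s + d)" "\<not> adjacent (s + d) (s - d)"
    using double_shift[OF d] double_shift[OF uminus_shift_dirs[OF d]] by (simp_all add: adjacent_iff)
  have irr: "\<not> adjacent t t" for t using adjacent_neq by blast
  have "polyomino_system ?S"
  proof (rule polyomino_system_convex)
    show "convex (\<Union>t\<in>?S. cell t)" using convex_triomino[OF d, of s] by (simp add: Un_assoc)
    show "(u, t) \<in> {(p, q). p \<in> ?S \<and> q \<in> ?S \<and> adjacent p q}\<^sup>*" if "u \<in> ?S" "t \<in> ?S" for u t
      using a that by (intro star_connected[of s]) auto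
  qed auto
  moreover have "card (neighbours ?S t) \<le> 2" if "t \<in> ?S" for t
    using card_neighbours_le[of ?S t] that ne by simp
  moreover have "\<exists>xs. distinct xs \<and> set xs = ?S \<and> (\<forall>i<length xs. \<forall>j<length xs.
      adjacent (xs ! i) (xs ! j) \<longleftrightarrow> j = i + 1 \<or> i = j + 1)"
    using a na irr ne
    by (intro exI[of _ "[s - d, s, s + d]"]) (auto simp: All_less_Suc numeral_3_eq_3)
  moreover have "\<not> kink ?S t" for t
  proof
    assume k: "kink ?S t"
    then have t: "t \<in> ?S" "card (neighbours ?S t) = 2"
      and "\<exists>v\<in>corners t. vdegree (edges ?S) v = 2"
      by (auto simp: kink_def non_terminal_def)
    have "neighbours ?S (s + d) = {s}" "neighbours ?S (s - d) = {s}"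
      using a na irr[of "s + d"] irr[of "s - d"] unfolding neighbours_def by blast+
    then have "card (neighbours ?S (s + d)) = 1" "card (neighbours ?S (s - d)) = 1"
      by (simp_all only: is_singletonI is_singleton_altdef[symmetric])
    then have "t \<noteq> s + d" "t \<noteq> s - d" using t(2) by force+
    then have "t = s" using t(1) by blast
    then obtain v where v: "v \<in> corners s" "vdegree (edges ?S) v = 2"
      using \<open>\<exists>v\<in>corners t. _\<close> by auto
    obtain p q where s: "s = (p, q)" by (cases s)
    have "v = (p, q) \<or> v = (p, q + 1) \<or> v = (p + 1, q) \<or> v = (p + 1, q + 1)"
      using v(1) by (auto simp: s corners_Pair)
    with d have "vdegree (edges ?S) v = 3"
      by (elim shift_dirs_cases disjE) (simp_all add: s vdegree_edges)
    then show False using v(2) by simp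
  qed
  ultimately show ?thesis
    unfolding linear_chain_def polyomino_chain_def by blast
qed

lemma vdegree_single:
  assumes "card {s \<in> T. v \<in> corners s} = 1"
  shows "vdegree (edges T) v = 2"
proof -
  obtain a b where v: "v = (a, b)" by (cases v)
  show ?thesis
    using assms unfolding v vdegree_edges card_squares_at
    by (cases "(a, b) \<in> T"; cases "(a, b - 1) \<in> T"; cases "(a - 1, b) \<in> T"; cases "(a - 1, b - 1) \<in> T"; simp)
qed

lemma diagonal_shift:
  assumes "p \<in> shift_dirs" "perp q p"
  shows "- p - q \<notin> shift_dirs \<and> - p - q \<noteq> 0"
proof -
  have "q \<in> shift_dirs" using assms(2) by (simp add: perp_def)
  with assms show ?thesis
    by (elim shift_dirs_cases; simp add: perp_def shift_dirs_def zero_prod_def)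
qed

text \<open>This is the corner of \<open>s\<close> away from both neighbours \<open>s + p\<close>
  and \<open>s + q\<close>; it will have degree 2 at a kink.\<close>

lemma outer_corner:
  assumes "p \<in> shift_dirs" "perp q p"
  obtains v where "v \<in> corners s" "\<And>r. v \<in> corners r \<Longrightarrow> r \<in> {s, s - p, s - q, s - p - q}"
    "v \<in> corners (s - p - q)"
proof -
  obtain a b where s: "s = (a, b)" by (cases s)
  have q: "q \<in> shift_dirs" using assms(2) by (simp add: perp_def)
  \<comment> \<open>A coordinate of \<open>p + q\<close> equal to -1 means a neighbour on the low
    side, so the outer corner takes the high coordinate there.\<close>
  define v where "v = (a + of_bool (fst p + fst q = - 1), b + of_bool (snd p + snd q = - 1))"
  have at: "r \<in> {(c, d), (c, d - 1), (c - 1, d), (c - 1, d - 1)}" if "(c, d) \<in> corners r" for r c d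
    using that by (cases r) (auto simp: corners_Pair)
  have "v \<in> corners s \<and> v \<in> corners (s - p - q) \<and> {(fst v, snd v), (fst v, snd v - 1), (fst v - 1, snd v), (fst v - 1, snd v - 1)}
      \<subseteq> {s, s - p, s - q, s - p - q}"
    using assms q unfolding v_def
    by (elim shift_dirs_cases) (simp_all add: s corners_Pair perp_def)
  then show thesis using that[of v] at[of "fst v" "snd v"] by auto
qed

section \<open>Bends, kinks and maximal linear subchains\<close>

context square_path
begin

lemma neighbours_inner:
  assumes "0 < i" "i + 1 < n" "T \<subseteq> C" "x (i - 1) \<in> T" "x (i + 1) \<in> T"
  shows "card (neighbours T (x i)) = 2"
proof -
  have "neighbours T (x i) = {x (i - 1), x (i + 1)}"
  proof
    show "{x (i - 1), x (i + 1)} \<subseteq> neighbours T (x i)"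
      using assms adj[of i "i - 1"] adj[of i "i + 1"] by (auto simp: neighbours_def)
    show "neighbours T (x i) \<subseteq> {x (i - 1), x (i + 1)}"
    proof
      fix t assume "t \<in> neighbours T (x i)"
      then have t: "t \<in> T" "adjacent (x i) t" by (auto simp: neighbours_def)
      then obtain j where "j < n" "t = x j" using assms(3) by auto
      then show "t \<in> {x (i - 1), x (i + 1)}" using t adj[of i j] assms by auto
    qed
  qed
  then show ?thesis using x_eq_iff[of "i - 1" "i + 1"] assms by simp
qed

text \<open>No square but \<open>x i\<close> lies at the outer corner: the lateral ones would be
  further neighbours of \<open>x i\<close>, and the diagonal one would require a lateral one by
  \<open>diagonal_filled\<close>. The set \<open>T\<close> is general so that the lemma also rules
  out linear subchains running through a bend.\<close>

lemma kink_at_bend: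
  assumes b: "bend i" and T: "T \<subseteq> C" "x (i - 1) \<in> T" "x i \<in> T" "x (i + 1) \<in> T"
  shows "kink T (x i)"
proof -
  have i: "0 < i" "i + 1 < n" "i < n" using b by (auto simp: bend_def)
  define p q where pq_def: "p = x (i - 1) - x i" "q = x (i + 1) - x i"
  have p: "p \<in> shift_dirs" and q: "q \<in> shift_dirs"
    unfolding pq_def using back_dir[OF i(1,3)] step_dir[OF i(2)] by auto
  have "x (i + 1) \<noteq> x (i - 1)" using x_eq_iff[of "i + 1" "i - 1"] i by simp
  then have "q \<noteq> p" by (simp add: pq_def)
  moreover have "q \<noteq> - p" using b bend_iff[OF i(1,2)] unfolding pq_def by (metis minus_minus)
  ultimately have qp: "perp q p" using q unfolding perp_def by blast
  obtain v where v: "v \<in> corners (x i)"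
    "\<And>r. v \<in> corners r \<Longrightarrow> r \<in> {x i, x i - p, x i - q, x i - p - q}"
    "v \<in> corners (x i - p - q)"
    using outer_corner[OF p qp, of "x i"] by blast
  have out: "x i + u \<notin> C" if "u \<in> shift_dirs" "u \<noteq> p" "u \<noteq> q" for u
  proof
    assume "x i + u \<in> C"
    then obtain j where j: "j < n" "x i + u = x j" by auto
    then have "adjacent (x i) (x j)" using that by (simp add: adjacent_iff flip: j(2))
    then have "j = i + 1 \<or> j = i - 1" using adj[of i j] j i by auto
    then show False using j that by (auto simp: pq_def algebra_simps)
  qed
  have pq: "- p \<in> shift_dirs" "- p \<noteq> p" "- p \<noteq> q" "- q \<in> shift_dirs" "- q \<noteq> q" "- q \<noteq> p"
    "- p - q \<notin> shift_dirs" "- p - q \<noteq> 0"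
  proof -
    show "- p \<in> shift_dirs" "- p \<noteq> p" "- p \<noteq> q" "- q \<in> shift_dirs" "- q \<noteq> q" "- q \<noteq> p"
      using shift_dirs_perp[OF p qp] uminus_shift_dirs p q by auto
    show "- p - q \<notin> shift_dirs" "- p - q \<noteq> 0"
      using diagonal_shift[OF p qp] by simp_all
  qed
  have o: "x i - p \<notin> C" "x i - q \<notin> C"
    using out[of "- p"] out[of "- q"] pq by simp_all
  have "x i - p - q \<notin> C"
  proof
    assume dC: "x i - p - q \<in> C"
    have "\<not> adjacent (x i) (x i - p - q)" "x i \<noteq> x i - p - q"
    proof -
      have "x i - p - q - x i = - p - q" by simp
      then show "\<not> adjacent (x i) (x i - p - q)" "x i \<noteq> x i - p - q"
        using pq(7,8) unfolding adjacent_iff by (metis, metis diff_self)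
    qed
    then obtain r where "r \<in> C" "r \<noteq> x i" "r \<noteq> x i - p - q" "v \<in> corners r"
      using diagonal_filled[of "x i", OF _ dC _ _ v(1,3)] i by blast
    then show False using v(2)[of r] o unfolding insert_iff empty_iff by metis
  qed
  then have "r = x i" if "r \<in> T" "v \<in> corners r" for r
    using v(2)[OF that(2)] o that(1) T(1) unfolding insert_iff empty_iff by (metis subsetD)
  then have "{s \<in> T. v \<in> corners s} = {x i}"
    using v(1) T(3) by blast
  then have "vdegree (edges T) v = 2" by (intro vdegree_single) simp
  then show ?thesis
    unfolding kink_def non_terminal_def
    using neighbours_inner[OF i(1,2) T(1,2,4)] T(3) v(1) by blast
qed

lemma polyomino_chain_connected:
  assumes "polyomino_chain T" "S \<subseteq> T" "s \<in> S" "t \<in> T" "t \<notin> S"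
  obtains u w where "u \<in> S" "w \<in> T" "w \<notin> S" "adjacent u w"
proof -
  have "(s, t) \<in> {(p, q). p \<in> T \<and> q \<in> T \<and> adjacent p q}\<^sup>*"
    using assms unfolding polyomino_chain_def polyomino_system_def by blast
  then have "t \<in> S \<or> (\<exists>u w. u \<in> S \<and> w \<in> T \<and> w \<notin> S \<and> adjacent u w)"
    using assms(3) by (induction rule: rtrancl_induct) auto
  then show thesis using assms(5) that by blast
qed

text \<open>A larger linear subchain would, being connected, contain \<open>x (a - 1)\<close> or
  \<open>x (b + 1)\<close>. Then \<open>x a\<close> or \<open>x b\<close> would be a bend with both
  neighbours present, hence a kink of the subchain.\<close>

lemma segment_between_bends:
  assumes ab: "a < b" "b < n" "a = 0 \<or> bend a" "b + 1 = n \<or> bend b"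
    and lin: "linear_chain (x ` {a..b})"
  shows "segment C (x ` {a..b})"
  unfolding segment_def
proof (intro conjI allI impI)
  show "x ` {a..b} \<subseteq> C" using ab by auto
  show "linear_chain (x ` {a..b})" by (rule lin)
  fix T assume T: "x ` {a..b} \<subseteq> T \<and> T \<subseteq> C \<and> linear_chain T"
  show "T = x ` {a..b}"
  proof (rule ccontr)
    assume "T \<noteq> x ` {a..b}"
    then obtain t where "t \<in> T" "t \<notin> x ` {a..b}" using T by blast
    moreover have "polyomino_chain T" "x ` {a..b} \<subseteq> T" using T by (auto simp: linear_chain_def)
    moreover have "x a \<in> x ` {a..b}" using ab by auto
    ultimately obtain u w where uw: "u \<in> x ` {a..b}" "w \<in> T" "w \<notin> x ` {a..b}" "adjacent u w"
      using polyomino_chain_connected by metis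
    obtain i where i: "a \<le> i" "i \<le> b" "u = x i" using uw by auto
    obtain j where j: "j < n" "w = x j" using uw(2) T by auto
    have "\<not> (a \<le> j \<and> j \<le> b)" using uw(3) j by auto
    moreover have "j = i + 1 \<or> i = j + 1" using uw(4) adj[of i j] i j ab by auto
    \<comment> \<open>The condition \<open>0 < a\<close> records that \<open>a - 1\<close> is a true
      predecessor and not a truncated difference.\<close>
    ultimately consider "j = a - 1" "0 < a" | "j = b + 1" using i by linarith
    then show False
    proof cases
      case 1
      have "x a \<in> T" "x (a + 1) \<in> T" using T ab by auto
      then have "kink T (x a)"
        using 1 ab T uw(2) j by (intro kink_at_bend) auto
      then show False using T \<open>x a \<in> T\<close> by (auto simp: linear_chain_def)
    next
      case 2
      have "x b \<in> T" "x (b - 1) \<in> T" using T ab by auto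
      then have "kink T (x b)"
        using 2 ab T uw(2) j by (intro kink_at_bend) auto
      then show False using T \<open>x b \<in> T\<close> by (auto simp: linear_chain_def)
    qed
  qed
qed

text \<open>Each of the squares at \<open>i\<close> and \<open>i + 1\<close> ends a segment, as a
  bend or as an end of the chain; \<open>i + 2 = n\<close> says that \<open>i + 1\<close> is the
  last position.\<close>

definition short_pair :: "nat \<Rightarrow> bool" where
  "short_pair i \<longleftrightarrow> (i = 0 \<or> bend i) \<and> (i + 2 = n \<or> bend (i + 1))"

lemma straight_triple:
  assumes "0 < i" "i + 1 < n" "\<not> bend i"
  shows "x (i + 1) = x i + (x i - x (i - 1))" "x (i - 1) = x i - (x i - x (i - 1))"
    "x i - x (i - 1) \<in> shift_dirs"
proof -
  have "x (i + 1) - x i = x i - x (i - 1)" using assms by (simp add: bend_def)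
  then show "x (i + 1) = x i + (x i - x (i - 1))" "x i - x (i - 1) \<in> shift_dirs"
    using step_dir[OF assms(2)] by (metis diff_add_cancel add.commute, metis)
  show "x (i - 1) = x i - (x i - x (i - 1))" by simp
qed

lemma linear_chain_straight:
  assumes "0 < i" "i + 1 < n" "\<not> bend i"
  shows "linear_chain {x i, x (i + 1), x (i - 1)}"
  using linear_chain_triomino[OF straight_triple(3)[OF assms], of "x i"] straight_triple(1,2)[OF assms]
  by simp

text \<open>A short pair is a stretch between two segment ends. Conversely, a pair with an inner
  square that is not a bend extends to a straight triple, against maximality.\<close>

lemma segment_two_iff:
  assumes "3 \<le> n"
  shows "(\<exists>S. segment C S \<and> card S = 2) \<longleftrightarrow> (\<exists>i. i + 1 < n \<and> short_pair i)"
proof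
  assume "\<exists>i. i + 1 < n \<and> short_pair i"
  then obtain i where i: "i + 1 < n" "short_pair i" by blast
  have eq: "x ` {i..i + 1} = {x i, x (i + 1)}" by (auto simp: atLeastAtMost_insertL[symmetric] le_Suc_eq)
  have "linear_chain (x ` {i..i + 1})"
    using linear_chain_domino[OF step_dir[OF i(1)], of "x i"] unfolding eq by simp
  then have "segment C (x ` {i..i + 1})"
    using i by (intro segment_between_bends) (auto simp: short_pair_def)
  moreover have "card (x ` {i..i + 1}) = 2" unfolding eq using x_eq_iff[of i "i + 1"] i by simp
  ultimately show "\<exists>S. segment C S \<and> card S = 2" by blast
next
  assume "\<exists>S. segment C S \<and> card S = 2"
  then obtain S where S: "segment C S" "card S = 2" by blast
  then have SC: "S \<subseteq> C" and chain: "polyomino_chain S"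
    and maxim: "\<And>T. S \<subseteq> T \<Longrightarrow> T \<subseteq> C \<Longrightarrow> linear_chain T \<Longrightarrow> T = S"
    by (auto simp: segment_def linear_chain_def)
  obtain s t where st: "S = {s, t}" "s \<noteq> t" using S(2) by (meson card_2_iff)
  have "adjacent s t"
  proof -
    obtain u w where "u \<in> {s}" "w \<in> S" "w \<notin> {s}" "adjacent u w"
      by (rule polyomino_chain_connected[OF chain, of "{s}" s t]) (use st in auto)
    then show ?thesis using st by auto
  qed
  obtain k l where kl: "k < n" "l < n" "s = x k" "t = x l" using SC st by auto
  then have "l = k + 1 \<or> k = l + 1" using adj \<open>adjacent s t\<close> by simp
  then obtain i where i: "i + 1 < n" "S = {x i, x (i + 1)}"
    using kl st by (metis insert_commute)
  have no: "False" if j: "0 < j" "j + 1 < n" "\<not> bend j" "S \<subseteq> {x j, x (j + 1), x (j - 1)}" for j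
  proof -
    have "{x j, x (j + 1), x (j - 1)} = S"
      using maxim[OF j(4) _ linear_chain_straight[OF j(1-3)]] j by auto
    moreover have "card {x j, x (j + 1), x (j - 1)} = 3"
      using x_eq_iff[of j "j + 1"] x_eq_iff[of j "j - 1"] x_eq_iff[of "j + 1" "j - 1"] j by auto
    ultimately show False using S(2) by simp
  qed
  have "i = 0 \<or> bend i" using no[of i] i by auto
  moreover have "i + 2 = n \<or> bend (i + 1)"
  proof (rule disjCI)
    assume "\<not> bend (i + 1)"
    then have "\<not> i + 2 < n" using no[of "i + 1"] i by auto
    then show "i + 2 = n" using i by linarith
  qed
  ultimately show "\<exists>i. i + 1 < n \<and> short_pair i" using i unfolding short_pair_def by blast
qed

lemma corners_cover:
  assumes "d \<in> shift_dirs" "v \<in> corners s"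
  shows "v \<in> corners (s + d) \<or> v \<in> corners (s - d)"
  using assms by (cases s; cases v) (elim shift_dirs_cases; auto simp: corners_Pair)

text \<open>This links the condition defining \<open>Omega\<close> to the computation of weights.
  The side of \<open>x i\<close> facing away from both turns has degree sum 6, and each of its ends
  lies on a second square, so both ends have degree exactly 3.\<close>

lemma U_shape:
  assumes i: "0 < i" "i + 1 < n" "\<not> bend i" "bend (i - 1)" "bend (i + 1)"
    and U: "x (i - 2) - x (i - 1) = x (i + 2) - x (i + 1)"
  obtains S where "internal_segment C S" "card S = 3"
    "\<exists>e\<in>edges S. \<forall>v\<in>e. vdegree (edges C) v = 3"
proof -
  have i': "i < n" "1 < i" "i + 2 < n" using i by (auto simp: bend_def)
  let ?S = "x ` {i - 1..i + 1}"
  have "{i - 1..i + 1} = {i, i + 1, i - 1}" using i by auto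
  then have S: "?S = {x i, x (i + 1), x (i - 1)}" by simp
  have lin: "linear_chain ?S" unfolding S by (rule linear_chain_straight[OF i(1-3)])
  have seg: "segment C ?S" using i lin by (intro segment_between_bends) auto
  have "\<not> terminal C (x j)" if "j \<in> {i - 1..i + 1}" for j
  proof -
    have "0 < j" "j + 1 < n" using that i' by auto
    then show ?thesis using neighbours_inner[of j C] by (auto simp: terminal_def)
  qed
  then have "internal_segment C ?S"
    using seg unfolding internal_segment_def external_segment_def by blast
  moreover have "card ?S = 3"
  proof -
    have "{i - 1..i + 1} \<subseteq> {..<n}" using i by (intro subsetI) simp
    then have "card ?S = card {i - 1..i + 1}" by (intro card_image inj_on_subset[OF inj])
    then show ?thesis using i by simp
  qed
  moreover have "\<exists>e\<in>edges ?S. \<forall>v\<in>e. vdegree (edges C) v = 3"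
  proof -
    let ?d = "x i - x (i - 1)" and ?t = "turn_fwd i"
    note d = straight_triple[OF i(1-3)]
    have q: "x (i + 1) - x i = ?d" using i by (simp add: bend_def)
    have p: "x (i - 1) - x i = - ?d" by simp
    have t: "perp ?t ?d" using perp_turn_fwd[OF i(2)] q by simp
    have tb: "turn_bwd i = ?t" using U i by (simp add: turn_fwd_def turn_bwd_def)
    have tp: "perp ?t (- ?d)" using t by (auto simp: perp_def)
    have u: "- ?t \<in> shift_dirs" using t uminus_shift_dirs by (simp add: perp_def)
    define e where "e = shared_side (x i) (- ?t)"
    have "deg_sum e = 6"
      unfolding e_def deg_sum_eq[OF i'(1) u] bwd_arm[OF i(1) i'(1) u] fwd_arm[OF i(2) u] tb p q
      using arm_eq(4)[OF d(3) t] arm_eq(4)[OF uminus_shift_dirs[OF d(3)] tp] by simp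
    moreover have ge: "3 \<le> vdegree (edges C) v" if "v \<in> e" for v
    proof -
      have v: "v \<in> corners (x i)" using that by (simp add: e_def shared_side_def)
      then obtain j where j: "j < n" "j \<noteq> i" "v \<in> corners (x j)"
        using corners_cover[OF d(3) v] d(1,2) i by (metis add_lessD1 add_cancel_left_right add_diff_inverse_nat less_one less_imp_diff_less not_add_less2 one_neq_zero)
      have "{x i, x j} \<subseteq> {s \<in> C. v \<in> corners s}" using v j i' by auto
      then have "card {x i, x j} \<le> card {s \<in> C. v \<in> corners s}" by (intro card_mono) auto
      then show ?thesis using vdegree_eq[of "x i" v] v i' x_eq_iff[of i j] j by simp
    qed
    moreover obtain v w where vw: "e = {v, w}" "v \<noteq> w"
      using card_shared_side[OF u, of "x i"] unfolding e_def by (meson card_2_iff)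
    ultimately have "vdegree (edges C) v + vdegree (edges C) w = 6" by (simp add: deg_sum_def)
    moreover have "3 \<le> vdegree (edges C) v" "3 \<le> vdegree (edges C) w" using ge vw by simp_all
    ultimately have "vdegree (edges C) v = 3" "vdegree (edges C) w = 3" by linarith+
    moreover have "e \<in> edges ?S"
      unfolding edges_def S e_def using u by (auto simp: sides_eq_shared_side)
    ultimately show ?thesis using vw(1) by (intro bexI[of _ e]) simp_all
  qed
  ultimately show thesis using that by blast
qed

section \<open>The index as a sum over consecutive pairs\<close>

lemma sum_connectivity_eq:
  fixes \<alpha> :: real
  assumes "2 \<le> n"
    and no_U: "\<And>i. 0 < i \<Longrightarrow> i + 1 < n \<Longrightarrow> \<not> bend i \<Longrightarrow> bend (i - 1) \<Longrightarrow> bend (i + 1) \<Longrightarrow>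
      x (i - 2) - x (i - 1) \<noteq> x (i + 2) - x (i + 1)"
  defines "f \<equiv> \<lambda>k :: nat. real k powr \<alpha>" and "b \<equiv> \<lambda>i. of_bool (bend i) :: nat"
  shows "sum_connectivity \<alpha> (edges C) = 2 * (f 4 + f 5) + (\<Sum>i<n - 1.
    (if i = 0 then f (5 + b 1) + f (6 + b 1) else cell_share f (b i) (b (i + 1)))
    + (if i + 2 = n then f (5 + b i) + f (6 + b i) else cell_share f (b (i + 1)) (b i))
    - f (6 + b i + b (i + 1)))"
proof -
  define R where "R = (\<lambda>i. if i = 0 then f (5 + b 1) + f (6 + b 1) else cell_share f (b i) (b (i + 1)))"
  define L where "L = (\<lambda>i. if i + 2 = n then f (5 + b i) + f (6 + b i) else cell_share f (b (i + 1)) (b i))"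
  obtain m where m: "n = Suc m" "0 < m" using assms(1) by (cases n) auto
  \<comment> \<open>The share of \<open>x i\<close> towards \<open>x (i + 1)\<close> is
    \<open>R i\<close>, and the share towards \<open>x (i - 1)\<close> is booked under the preceding
    pair as \<open>L (i - 1)\<close>. At an end of the chain \<open>f 4 + f 5\<close> stands in for
    the missing share.\<close>
  have cell: "(\<Sum>e\<in>sides (x i). f (deg_sum e))
      = (if i = m then f 4 + f 5 else R i) + (case i of 0 \<Rightarrow> f 4 + f 5 | Suc j \<Rightarrow> L j)" if "i < n" for i
  proof -
    have "i = 0 \<or> 0 < i \<and> i = m \<or> 0 < i \<and> i + 1 < n" using that m by linarith
    then consider "i = 0" | "0 < i" "i = m" | "0 < i" "i + 1 < n" by blast
    then show ?thesis
    proof cases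
      case 1
      then show ?thesis using sum_first_cell[of f] m by (simp add: R_def b_def)
    next
      case 2
      obtain j where j: "i = Suc j" using 2 by (cases i) auto
      have "L j = f (5 + b j) + f (6 + b j)" using 2 m j by (simp add: L_def)
      moreover have "(\<Sum>e\<in>sides (x i). f (deg_sum e)) = f 4 + f 5 + (f (5 + b j) + f (6 + b j))"
      proof -
        have "0 < i" "i + 1 = n" "i - 1 = j" using 2 m(1) j by simp_all
        then show ?thesis using sum_last_cell[of i f] by (simp add: b_def)
      qed
      moreover have "(case i of 0 \<Rightarrow> f 4 + f 5 | Suc j \<Rightarrow> L j) = L j" by (simp add: j)
      ultimately show ?thesis using 2(2) by simp
    next
      case 3
      obtain j where j: "i = Suc j" using 3 by (cases i) auto
      have "L j = cell_share f (b i) (b (i - 1))" "R i = cell_share f (b i) (b (i + 1))" "i \<noteq> m"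
        using 3 m(1) j by (simp_all add: L_def R_def)
      moreover have "(case i of 0 \<Rightarrow> f 4 + f 5 | Suc j \<Rightarrow> L j) = L j" by (simp add: j)
      ultimately show ?thesis
        using sum_middle_cell[OF 3 no_U[OF 3], of f] by (simp add: b_def)
    qed
  qed
  have "sum_connectivity \<alpha> (edges C) = (\<Sum>e\<in>edges C. f (deg_sum e))"
    unfolding sum_connectivity_def deg_sum_def f_def ..
  also have "\<dots> = (\<Sum>e\<in>edges (x ` {..<Suc m}). f (deg_sum e))"
    by (simp only: m(1))
  also have "\<dots> = (\<Sum>i<Suc m. \<Sum>e\<in>sides (x i). f (deg_sum e))
      - (\<Sum>i<m. f (deg_sum (shared_side (x i) (x (i + 1) - x i))))"
    using sum_edges_prefix[of m] m by simp
  also have "(\<Sum>i<m. f (deg_sum (shared_side (x i) (x (i + 1) - x i)))) = (\<Sum>i<m. f (6 + b i + b (i + 1)))"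
    using deg_sum_shared m by (intro sum.cong) (simp_all add: b_def)
  also have "(\<Sum>i<Suc m. \<Sum>e\<in>sides (x i). f (deg_sum e))
      = (\<Sum>i<Suc m. if i = m then f 4 + f 5 else R i)
        + (\<Sum>i<Suc m. case i of 0 \<Rightarrow> f 4 + f 5 | Suc j \<Rightarrow> L j)"
    unfolding sum.distrib[symmetric] using cell m by (intro sum.cong) simp_all
  also have "(\<Sum>i<Suc m. if i = m then f 4 + f 5 else R i) = (\<Sum>i<m. R i) + (f 4 + f 5)"
    by simp
  also have "(\<Sum>i<Suc m. case i of 0 \<Rightarrow> f 4 + f 5 | Suc j \<Rightarrow> L j) = (f 4 + f 5) + (\<Sum>i<m. L i)"
    by (simp add: sum.lessThan_Suc_shift del: sum.lessThan_Suc)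
  finally have "sum_connectivity \<alpha> (edges C)
    = 2 * (f 4 + f 5) + (\<Sum>i<m. R i + L i - f (6 + b i + b (i + 1)))"
    by (simp add: sum.distrib sum_subtractf)
  moreover have "n - 1 = m" using m by simp
  ultimately show ?thesis unfolding R_def L_def by (simp only:)
qed

text \<open>
  By the equation for \<open>\<alpha>\<close> a kink flanked by straight squares costs nothing, so only pairs of
  consecutive squares that are both kinks or terminal contribute to the defect.
\<close>

lemma sum_connectivity_defect:
  fixes \<alpha> :: real
  assumes n: "3 \<le> n"
    and no_U: "\<And>i. 0 < i \<Longrightarrow> i + 1 < n \<Longrightarrow> \<not> bend i \<Longrightarrow> bend (i - 1) \<Longrightarrow> bend (i + 1) \<Longrightarrow>
      x (i - 2) - x (i - 1) \<noteq> x (i + 2) - x (i + 1)"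
    and \<alpha>: "2 * 5 powr \<alpha> - 6 powr (\<alpha> + 1) + 4 * 7 powr \<alpha> = 0"
  shows "sum_connectivity \<alpha> (edges C) =
    3 * 6 powr \<alpha> * real n + (2 * 4 powr \<alpha> + 2 * 5 powr \<alpha> + 6 powr \<alpha> - 4 * 7 powr \<alpha>)
    - (\<Sum>i<n - 1. if short_pair i then 6 powr \<alpha> - (if i = 0 \<or> i + 2 = n then 7 else 8) powr \<alpha> else 0)"
proof -
  define f where "f = (\<lambda>k :: nat. real k powr \<alpha>)"
  define b where "b = (\<lambda>i. of_bool (bend i) :: nat)"
  define defect where "defect = (\<lambda>i. if short_pair i
    then 6 powr \<alpha> - (if i = 0 \<or> i + 2 = n then 7 else 8) powr \<alpha> else 0)"
  have f: "f 4 = 4 powr \<alpha>" "f 5 = 5 powr \<alpha>" "f 6 = 6 powr \<alpha>" "f 7 = 7 powr \<alpha>" "f 8 = 8 powr \<alpha>"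
    by (simp_all add: f_def)
  \<comment> \<open>An inner pair with exactly one bend has weight \<open>f 5 + 2 * f 7\<close>, one
    without bends \<open>3 * f 6\<close>; the equation makes them equal. With two bends the weight
    is \<open>2 * f 6 + f 8\<close>, short by \<open>f 6 - f 8\<close>.\<close>
  have eq: "2 * f 5 + 4 * f 7 = 6 * f 6"
    using \<alpha> by (simp add: f powr_add)
  have "(if i = 0 then f (5 + b 1) + f (6 + b 1) else cell_share f (b i) (b (i + 1)))
    + (if i + 2 = n then f (5 + b i) + f (6 + b i) else cell_share f (b (i + 1)) (b i))
    - f (6 + b i + b (i + 1))
    = 3 * f 6 + (if i = 0 then f 5 - f 6 else 0) + (if i = n - 2 then f 5 - f 6 else 0) - defect i"
    if i: "i < n - 1" for i
  proof -
    \<comment> \<open>With at least three squares no pair consists of both ends of the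
      chain.\<close>
    have "i \<noteq> 0 \<or> i + 2 \<noteq> n" using n by linarith
    then consider "i = 0" "i + 2 \<noteq> n" | "i \<noteq> 0" "i + 2 = n" | "i \<noteq> 0" "i + 2 \<noteq> n" by blast
    then show ?thesis
    proof cases
      case 1
      then have "\<not> bend 0" "0 \<noteq> n - 2" using n by (auto simp: bend_def)
      then show ?thesis
        using 1 eq by (cases "bend 1") (simp_all add: b_def cell_share_def defect_def short_pair_def f)
    next
      case 2
      then have "\<not> bend (i + 1)" "i = n - 2" by (auto simp: bend_def)
      then show ?thesis
        using 2 eq by (cases "bend i") (simp_all add: b_def cell_share_def defect_def short_pair_def f)
    next
      case 3
      then have "i \<noteq> n - 2" using n by auto
      then show ?thesis
        using 3 eq
        by (cases "bend i"; cases "bend (i + 1)")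
          (simp_all add: b_def cell_share_def defect_def short_pair_def f)
    qed
  qed
  then have "sum_connectivity \<alpha> (edges C) = 2 * (f 4 + f 5) + (\<Sum>i<n - 1. 3 * f 6
      + (if i = 0 then f 5 - f 6 else 0) + (if i = n - 2 then f 5 - f 6 else 0) - defect i)"
    using sum_connectivity_eq[OF _ no_U, of \<alpha>] n unfolding f_def b_def by simp
  also have "\<dots> = 2 * (f 4 + f 5) + (3 * f 6 * (real n - 1) + 2 * (f 5 - f 6)) - (\<Sum>i<n - 1. defect i)"
  proof -
    \<comment> \<open>Both end positions lie in the range of summation, so the correction
      \<open>f 5 - f 6\<close> occurs once for each.\<close>
    have "n - 2 < n - 1" "0 < n - 1" using n by simp_all
    then show ?thesis using n by (simp add: sum.distrib sum_subtractf of_nat_diff)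
  qed
  \<comment> \<open>The constant so far is \<open>2 * f 4 + 4 * f 5 - 5 * f 6\<close>; by
    \<open>eq\<close>, \<open>2 * f 5 - 5 * f 6\<close> equals \<open>f 6 - 4 * f 7\<close>.\<close>
  also have "\<dots> = 3 * f 6 * real n + (2 * f 4 + 2 * f 5 + f 6 - 4 * f 7) - (\<Sum>i<n - 1. defect i)"
    using eq by (simp add: algebra_simps)
  finally show ?thesis unfolding f defect_def .
qed

end

theorem proposition2p6:
  fixes \<alpha> :: real and n :: nat and B :: "square set"
  assumes "2 * 5 powr \<alpha> - 6 powr (\<alpha> + 1) + 4 * 7 powr \<alpha> = 0"
    and "\<bar>\<alpha> - (- 3.09997)\<bar> < 0.000005"
    and "n \<ge> 3"
    and "B \<in> Omega n"
  shows "sum_connectivity \<alpha> (edges B)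
      \<le> 3 * 6 powr \<alpha> * real n + (2 * 4 powr \<alpha> + 2 * 5 powr \<alpha> + 6 powr \<alpha> - 4 * 7 powr \<alpha>)
    \<and> (sum_connectivity \<alpha> (edges B)
      = 3 * 6 powr \<alpha> * real n + (2 * 4 powr \<alpha> + 2 * 5 powr \<alpha> + 6 powr \<alpha> - 4 * 7 powr \<alpha>)
      \<longleftrightarrow> \<not> (\<exists>S. segment B S \<and> card S = 2))"
proof -
  have chain: "polyomino_chain B" and card: "card B = n"
    and U: "\<And>S. internal_segment B S \<Longrightarrow> card S = 3 \<Longrightarrow>
      \<not> (\<exists>e\<in>edges S. \<forall>v\<in>e. vdegree (edges B) v = 3)"
    using assms(4) by (simp_all add: Omega_def)
  obtain xs where xs: "distinct xs" "set xs = B"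
    and adj: "\<forall>i<length xs. \<forall>j<length xs. adjacent (xs ! i) (xs ! j) \<longleftrightarrow> j = i + 1 \<or> i = j + 1"
    using chain unfolding polyomino_chain_def by blast
  have len: "length xs = n" using xs card distinct_card by fastforce
  have B: "(!) xs ` {..<n} = B" using xs(2) len by (auto simp: set_conv_nth)
  interpret square_path "(!) xs" n
  proof
    show "inj_on ((!) xs) {..<n}" using xs(1) len by (simp add: inj_on_nth)
    show "polyomino_system ((!) xs ` {..<n})"
      using chain unfolding B polyomino_chain_def by blast
  qed (use adj len in blast)
  define defect where "defect = (\<lambda>i. if short_pair i
    then 6 powr \<alpha> - (if i = 0 \<or> i + 2 = n then 7 else 8) powr \<alpha> else 0)"
  have "sum_connectivity \<alpha> (edges C) =
    3 * 6 powr \<alpha> * real n + (2 * 4 powr \<alpha> + 2 * 5 powr \<alpha> + 6 powr \<alpha> - 4 * 7 powr \<alpha>)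
    - (\<Sum>i<n - 1. defect i)"
    unfolding defect_def
  \<comment> \<open>Membership in \<open>Omega\<close> excludes the U by
    \<open>U_shape\<close>.\<close>
  proof (rule sum_connectivity_defect[OF assms(3) _ assms(1)])
    fix i assume "0 < i" "i + 1 < n" "\<not> bend i" "bend (i - 1)" "bend (i + 1)"
    then show "xs ! (i - 2) - xs ! (i - 1) \<noteq> xs ! (i + 2) - xs ! (i + 1)"
      using U_shape[of i] U unfolding B by metis
  qed
  then have chi: "sum_connectivity \<alpha> (edges B) =
    3 * 6 powr \<alpha> * real n + (2 * 4 powr \<alpha> + 2 * 5 powr \<alpha> + 6 powr \<alpha> - 4 * 7 powr \<alpha>)
    - (\<Sum>i<n - 1. defect i)"
    unfolding B .
  \<comment> \<open>For a negative exponent the powers decrease with the base, so every short pair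
    has a strictly positive defect and equality means that there is none.\<close>
  have "\<alpha> < 0" using assms(2) by (simp add: abs_if split: if_splits)
  then have "7 powr \<alpha> < 6 powr \<alpha>" "8 powr \<alpha> < 6 powr \<alpha>"
    by (simp_all add: powr_less_mono2_neg)
  then have nonneg: "0 \<le> defect i" and zero: "defect i = 0 \<longleftrightarrow> \<not> short_pair i" for i
    by (auto simp: defect_def)
  have "(\<Sum>i<n - 1. defect i) = 0 \<longleftrightarrow> (\<forall>i<n - 1. \<not> short_pair i)"
    using sum_nonneg_eq_0_iff[of "{..<n - 1}" defect] nonneg zero by auto
  also have "\<dots> \<longleftrightarrow> \<not> (\<exists>S. segment B S \<and> card S = 2)"
    using segment_two_iff[OF assms(3)] unfolding B by (auto simp: less_diff_conv)
  finally show ?thesis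
    using chi sum_nonneg[of "{..<n - 1}" defect] nonneg by auto
qed

end
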